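(* Let $s_0\approx0.2374$ be the unique root in $(0,\tfrac12)$ of $t_1(s)=7+3^{3-2s}-2^{5-2s}$, and denote $$A_s:=\frac1{2\,\Gamma(4-2s)\cos(s\pi)}.$$ Then the fractional stiffness matrix $\boldsymbol S=(S_{kj})_{1\le k,j\le N-1}$ has the following properties. (i) If $s\in[s_0,1)$, then $S_{kk}>0$ and $S_{kj}<0$ for $k\ne j$, except that $S_{k,k\pm1}=0$ for $s=s_0$; and $\boldsymbol S$ is strictly positive diagonally dominated, i.e. $$S_{kk}>\sum_{j=1,\,j\ne k}^{N-1}|S_{kj}|,\qquad 1\le k\le N-1.\tag{$*$}$$ (ii) If $s\in(0,s_0)$, then $S_{kk}>0$, $S_{k,k\pm1}>0$, $S_{kj}<0$ for $|k-j|\ge2$, and $$S_{kk}-\sum_{j=1,\,j\ne k}^{N-1}|S_{kj}|>-\frac{4A_s\,t_1(s)}{h^{2s-1}},\qquad 1\le k\le N-1,$$ where $t_1(s)\in(0,2)$. However, the property $( * )$ holds only for $N\le N_0$ with $$N_0=\Big[2\Big(\frac{\gamma(s)}{t_1(s)}\Big)^{\frac1{2s}}\Big],\qquad\gamma(s):=(1-2s)(1-s)(3-2s).$$ (iii) If $s\in(1,\tfrac32)$, then $S_{kk}>0$, $S_{k,k\pm1}<0$, and $S_{kj}>0$ for $|k-j|\ge2$. The inequality in $( * )$ holds only for $k=1$ and $k=N-1$; on the contrary, for $N\ge4$, $$S_{kk}<\sum_{j=1,\,j\ne k}^{N-1}|S_{kj}|,\qquad 2\le k\le N-2.$$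
   Context: Let $\Omega=(a,b)$ be a finite interval, $N\ge2$ an integer, $h=(b-a)/N$, $x_j=a+jh$ for $0\le j\le N$. For $1\le j\le N-1$, $\phi_j:\mathbb R\to\mathbb R$ is the hat function equal to $\frac{x-x_{j-1}}h$ on $(x_{j-1},x_j)$, $\frac{x_{j+1}-x}h$ on $(x_j,x_{j+1})$, continuous, and $0$ elsewhere. With $\mathscr F[u](\xi)=\frac1{\sqrt{2\pi}}\int_{\mathbb R}u(x)e^{-\mathrm i\xi x}dx$, the stiffness matrix is $S_{kj}=\int_{\mathbb R}|\xi|^{2s}\mathscr F[\phi_j](\xi)\overline{\mathscr F[\phi_k](\xi)}\,d\xi$, $1\le k,j\le N-1$, $s\in(0,\tfrac32)$. Explicitly, for $s\ne\frac12$, $S_{kj}=\frac{h^{1-2s}}{2\Gamma(4-2s)\cos(s\pi)}\,t_{|k-j|}$ with $t_p=\sum_{i=-2}^2c_i|p+i|^{3-2s}$, $c_0=6$, $c_{\pm1}=-4$, $c_{\pm2}=1$; for $s=\frac12$, $S_{kj}=\frac1{2\pi}\sum_{i=-2}^2c_i(p+i)^2\ln|p+i|$ with $p=|k-j|$ and the convention $0^2\ln0=0$. $[x]$ denotes the integer part of $x$.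
   Formalization: In (ii), "(∗) holds only for N ≤ N_0" is false as stated ((∗) still holds at N = N_0+1, e.g. s = 0.2, N = 420); it is replaced by: N ≤ N_0 implies (∗), and (∗) implies N ≤ N_0+2. *)

theory Defs
  imports "HOL-Analysis.Analysis"
begin

definition mesh_size :: "real \<Rightarrow> real \<Rightarrow> nat \<Rightarrow> real" where
  "mesh_size a b N = (b - a) / real N"

definition mesh_node :: "real \<Rightarrow> real \<Rightarrow> nat \<Rightarrow> nat \<Rightarrow> real" where
  "mesh_node a b N j = a + real j * mesh_size a b N"

(* Used only for 1 <= j <= N - 1, so that j - 1 does not truncate. *)
definition hat :: "real \<Rightarrow> real \<Rightarrow> nat \<Rightarrow> nat \<Rightarrow> real \<Rightarrow> real" where
  "hat a b N j x =
     (if mesh_node a b N (j - 1) \<le> x \<and> x \<le> mesh_node a b N j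
        then (x - mesh_node a b N (j - 1)) / mesh_size a b N
      else if mesh_node a b N j \<le> x \<and> x \<le> mesh_node a b N (j + 1)
        then (mesh_node a b N (j + 1) - x) / mesh_size a b N
      else 0)"

definition fourier :: "(real \<Rightarrow> real) \<Rightarrow> real \<Rightarrow> complex" where
  "fourier u \<xi> =
     complex_of_real (1 / sqrt (2 * pi)) *
     (LINT x|lborel. complex_of_real (u x) * exp (- (\<i> * complex_of_real (\<xi> * x))))"

definition stiffness_integral :: "real \<Rightarrow> real \<Rightarrow> nat \<Rightarrow> real \<Rightarrow> nat \<Rightarrow> nat \<Rightarrow> complex" where
  "stiffness_integral a b N s k j =
     (LINT \<xi>|lborel. complex_of_real (\<bar>\<xi>\<bar> powr (2 * s)) *
        fourier (hat a b N j) \<xi> * cnj (fourier (hat a b N k) \<xi>))"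

(* The entry as a real number, so that it can be compared with 0; that the integral
   is real is a separate claim. Row index k, column index j, both in {1..N-1}. *)
definition stiffness :: "real \<Rightarrow> real \<Rightarrow> nat \<Rightarrow> real \<Rightarrow> nat \<Rightarrow> nat \<Rightarrow> real" where
  "stiffness a b N s k j = Re (stiffness_integral a b N s k j)"

definition offdiag_sum :: "real \<Rightarrow> real \<Rightarrow> nat \<Rightarrow> real \<Rightarrow> nat \<Rightarrow> real" where
  "offdiag_sum a b N s k = (\<Sum>j\<in>{1..N-1} - {k}. \<bar>stiffness a b N s k j\<bar>)"

definition strictly_pos_diag_dominated :: "real \<Rightarrow> real \<Rightarrow> nat \<Rightarrow> real \<Rightarrow> bool" where
  "strictly_pos_diag_dominated a b N s \<longleftrightarrow>
     (\<forall>k\<in>{1..N-1}. stiffness a b N s k k > offdiag_sum a b N s k)"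

definition t1 :: "real \<Rightarrow> real" where
  "t1 s = 7 + 3 powr (3 - 2 * s) - 2 powr (5 - 2 * s)"

(* The open interval matters: 1/2 is also a root of t1. *)
definition s0 :: real where
  "s0 = (THE s. 0 < s \<and> s < 1/2 \<and> t1 s = 0)"

definition A_coeff :: "real \<Rightarrow> real" where
  "A_coeff s = 1 / (2 * Gamma (4 - 2 * s) * cos (s * pi))"

definition gam :: "real \<Rightarrow> real" where
  "gam s = (1 - 2 * s) * (1 - s) * (3 - 2 * s)"

(* N0 comes from the leading-order tail of a middle row. Diagonal dominance holds up to N0,
   but the exact cut-off is slightly larger (N0 + 1, and for some s it is N0 + 2), so
   dominance implies N <= N0 + 2 and does not imply N <= N0. *)
definition N0 :: "real \<Rightarrow> int" where
  "N0 s = \<lfloor>2 * (gam s / t1 s) powr (1 / (2 * s))\<rfloor>"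

end

theory Submission
  imports Defs "HOL-Real_Asymp.Real_Asymp"
begin

text \<open>
Let \<open>h\<close> be the mesh size and put \<open>\<Phi>(y) = \<bar>y\<bar> powr (3 - 2 s)\<close> for \<open>s < 1/2\<close>, its negative for
\<open>s > 1/2\<close>, and \<open>\<Phi>(y) = y\<^sup>2 ln \<bar>y\<bar>\<close> for \<open>s = 1/2\<close> (the function \<open>riesz\<close> below). The transform of
a hat function at the node \<open>c\<close> is a phase \<open>exp (- \<i> c \<xi>)\<close> times \<open>(1 - cos (h \<xi>)) / \<xi>\<^sup>2\<close>, up to a constant.
After rescaling, the entry at distance \<open>p\<close> from the diagonal is therefore \<open>h powr (1 - 2 s)\<close> times
the integral of \<open>\<bar>x\<bar> powr (2 s - 4) * 4 (1 - cos x)\<^sup>2 cos (p x)\<close>, and the trigonometric factor is the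
fourth central difference of \<open>cos (y x)\<close> in \<open>y\<close> at \<open>p\<close>. That difference does not see
quadratic polynomials in \<open>y\<close>, so \<open>cos (y x)\<close> may be replaced by its Taylor remainder near \<open>x = 0\<close>;
the integral then converges separately for each \<open>y\<close>, and substituting \<open>x \<rightarrow> x / y\<close> evaluates it as a
constant times \<open>\<Phi>(y)\<close> plus a quadratic. Hence every entry is a positive multiple of the fourth
central difference of \<open>\<Phi>\<close> at \<open>p\<close> (\<open>stiffness_eq\<close>). The constant is positive because the diagonal
integral is, and for \<open>s < 1/2\<close> a Laplace transform and a Beta integral identify it with \<open>A_coeff s\<close>
(\<open>kappa_eq\<close>).

Everything else is about one sequence. Let \<open>T m\<close> be the third difference of \<open>\<Phi>\<close> on the nodes
\<open>m - 1, m, m + 1, m + 2\<close> (\<open>third_diff\<close>). The fourth difference at \<open>p \<ge> 1\<close> is \<open>T p - T (p - 1)\<close>, and at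
\<open>0\<close> it is \<open>2 T 0\<close>, so all row sums telescope. The mean value theorem reads off the signs from the third
and fourth derivatives of \<open>\<Phi>\<close>: for \<open>m \<ge> 1\<close> the sequence \<open>T m\<close> is positive and decreasing if \<open>s < 1\<close>,
negative and increasing if \<open>s > 1\<close>, and \<open>T 0 > 0\<close> always. This settles all entries except those next to
the diagonal, whose sign is that of \<open>t1 s\<close> for \<open>s < 1/2\<close> and of \<open>- t1 s\<close> for \<open>s > 1/2\<close>. The sign
of \<open>t1\<close> follows from the strict convexity of \<open>7 * 2 powr (- x) + (3/2) powr x\<close>: this
function takes the value \<open>4\<close> at most twice, at \<open>x = 2\<close> (that is, \<open>s = 1/2\<close>) and at \<open>s = s0\<close>.

When all off-diagonal entries are nonpositive, the dominance gap of row \<open>k\<close> is the positive row sum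
\<open>T (k - 1) + T (N - 1 - k)\<close> up to the common scale. For \<open>s < s0\<close> every neighbour of the diagonal costs
\<open>2 t1 s\<close>, so interior rows are dominant exactly if \<open>T (k - 1) + T (N - 1 - k) > 4 t1 s\<close>. Here \<open>T m\<close>
is compared with \<open>\<Phi>''' (y) = 2 gam s * y powr (- 2 s)\<close>: it exceeds the value at \<open>y = m + 1\<close> and, for
\<open>m \<ge> 2\<close>, is at most the value at \<open>y = m\<close>. By convexity the middle row is the critical one, which puts
the threshold for \<open>N\<close> near \<open>2 (gam s / t1 s) powr (1 / (2 s))\<close>; the two comparisons cost less than the
rounding allowed by \<open>N0 s\<close> and \<open>N0 s + 2\<close>. For \<open>s > 1\<close> the gap of an interior row is
\<open>4 T 1 - T (k - 1) - T (N - 1 - k) < 0\<close>, while that of an end row is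
\<open>T 0 + 2 T 1 - T (N - 2) > 0\<close> (and \<open>2 T 0\<close> if \<open>N = 2\<close>).
\<close>

section \<open>Forward differences and the Riesz function\<close>

primrec forward_diff :: "nat \<Rightarrow> (real \<Rightarrow> real) \<Rightarrow> real \<Rightarrow> real" where
  "forward_diff 0 f = f"
| "forward_diff (Suc n) f = forward_diff n (\<lambda>x. f (x + 1) - f x)"

text \<open>The mean value theorem, iterated: a forward difference commutes with differentiation, so it can be
traded for a derivative one order at a time. Only continuity is needed at the left end \<open>a\<close>, which is
where the higher derivatives of \<open>riesz\<close> are unbounded.\<close>

lemma forward_diff_eq_derivative:
  fixes D :: "nat \<Rightarrow> real \<Rightarrow> real"
  assumes "continuous_on {a..} (D 0)"
    and "\<And>i x. i \<le> n \<Longrightarrow> x > a \<Longrightarrow> (D i has_real_derivative D (Suc i) x) (at x)"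
    and "y \<ge> a"
  shows "\<exists>z>y. forward_diff (Suc n) (D 0) y = D (Suc n) z"
  using assms(1,2)
proof (induction n arbitrary: D)
  case 0
  have "continuous_on {y..y + 1} (D 0)"
    by (rule continuous_on_subset[OF 0(1)]) (use \<open>y \<ge> a\<close> in auto)
  moreover have "D 0 differentiable (at x)" if "y < x" for x
    using 0(2)[of 0 x] that \<open>y \<ge> a\<close> by (auto simp: real_differentiable_def)
  ultimately obtain l z where z: "y < z" "DERIV (D 0) z :> l" "D 0 (y + 1) - D 0 y = l"
    using MVT[of y "y + 1" "D 0"] by auto
  moreover have "DERIV (D 0) z :> D 1 z" using 0(2)[of 0 z] z(1) \<open>y \<ge> a\<close> by simp
  ultimately have "l = D 1 z" using DERIV_unique by blast
  with z show ?case by auto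
next
  case (Suc n)
  define D' where "D' i x = D i (x + 1) - D i x" for i x
  have "continuous_on {a..} (\<lambda>x. D 0 (x + 1))"
    by (rule continuous_on_compose2[OF Suc.prems(1)]) (auto intro!: continuous_intros)
  then have "continuous_on {a..} (D' 0)"
    unfolding D'_def using Suc.prems(1) by (intro continuous_intros)
  moreover have "(D' i has_real_derivative D' (Suc i) x) (at x)" if "i \<le> n" "x > a" for i x
  proof -
    have "((\<lambda>x. D i (x + 1)) has_real_derivative D (Suc i) (x + 1)) (at x)"
      using Suc.prems(2)[of i "x + 1"] that by (simp add: DERIV_shift)
    then show ?thesis
      unfolding D'_def using Suc.prems(2)[of i x] that by (intro DERIV_diff) auto
  qed
  ultimately obtain z where z: "z > y" "forward_diff (Suc n) (D' 0) y = D' (Suc n) z"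
    using Suc.IH[of D'] by auto
  have "\<exists>w>z. w < z + 1 \<and> D (Suc n) (z + 1) - D (Suc n) z = (z + 1 - z) * D (Suc (Suc n)) w"
    by (rule MVT2) (use Suc.prems(2) z(1) \<open>y \<ge> a\<close> in auto)
  then obtain w where w: "w > z" "D' (Suc n) z = D (Suc (Suc n)) w" by (auto simp: D'_def)
  have "forward_diff (Suc (Suc n)) (D 0) y = forward_diff (Suc n) (D' 0) y"
    by (simp add: D'_def[abs_def])
  with z w show ?case by (metis less_trans)
qed

lemma forward_diff_3: "forward_diff 3 f y = f (y + 3) - 3 * f (y + 2) + 3 * f (y + 1) - f y"
  and forward_diff_4: "forward_diff 4 f y = f (y + 4) - 4 * f (y + 3) + 6 * f (y + 2) - 4 * f (y + 1) + f y"
  by (simp_all add: numeral_eq_Suc algebra_simps)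

text \<open>A multiple of the Riesz kernel of the operator \<open>\<bar>\<xi>\<bar> powr (2 s - 4)\<close>, normalised so that the
entries of the stiffness matrix are positive multiples of its fourth differences. At \<open>0\<close> the library
values \<open>ln 0 = 0\<close> and \<open>0 powr a = 0\<close> give the continuous extension.\<close>

definition riesz :: "real \<Rightarrow> real \<Rightarrow> real" where
  "riesz s y = (if s = 1/2 then y\<^sup>2 * ln \<bar>y\<bar> else sgn (1/2 - s) * \<bar>y\<bar> powr (3 - 2 * s))"

text \<open>The \<open>i\<close>-th derivative of \<open>riesz s\<close> on the positive half-line. For \<open>s = 1/2\<close> only \<open>i \<le> 4\<close> is covered.\<close>

definition riesz_deriv :: "real \<Rightarrow> nat \<Rightarrow> real \<Rightarrow> real" where
  "riesz_deriv s i y =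
     (if s = 1/2 then [y\<^sup>2 * ln y, 2 * y * ln y + y, 2 * ln y + 3, 2 / y, - 2 / y\<^sup>2] ! i
      else sgn (1/2 - s) * (\<Prod>j<i. 3 - 2 * s - real j) * y powr (3 - 2 * s - real i))"

lemma riesz_0 [simp]: "riesz s 0 = 0" and riesz_minus [simp]: "riesz s (- y) = riesz s y"
  by (simp_all add: riesz_def)

lemma riesz_eq_riesz_deriv: "y \<ge> 0 \<Longrightarrow> riesz s y = riesz_deriv s 0 y"
  by (simp add: riesz_def riesz_deriv_def)

lemma riesz_deriv_DERIV:
  assumes "y > 0" "s = 1/2 \<Longrightarrow> i < 4"
  shows "(riesz_deriv s i has_real_derivative riesz_deriv s (Suc i) y) (at y)"
proof (cases "s = 1/2")
  case True
  from assms(2)[OF True] consider "i = 0" | "i = 1" | "i = 2" | "i = 3" by linarith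
  then show ?thesis
    by cases (use True assms(1) in \<open>simp_all add: riesz_deriv_def[abs_def], (auto intro!: derivative_eq_intros simp: field_simps power2_eq_square)+\<close>)
next
  case False
  have *: "3 - 2 * s - real i - 1 = 3 - 2 * s - real (Suc i)" by simp
  have "((\<lambda>y. y powr (3 - 2 * s - real i)) has_real_derivative
          (3 - 2 * s - real i) * y powr (3 - 2 * s - real i - 1)) (at y)"
    using assms(1) by (rule has_real_derivative_powr)
  note DERIV_cmult[OF this, of "sgn (1/2 - s) * (\<Prod>j<i. 3 - 2 * s - real j)"]
  with False show ?thesis unfolding * by (simp add: riesz_deriv_def[abs_def] mult_ac)
qed

lemma continuous_on_riesz_deriv_0:
  assumes "s < 3/2"
  shows "continuous_on {0..} (riesz_deriv s 0)"
proof (cases "s = 1/2")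
  case False
  have "continuous_on {0..} (\<lambda>y::real. y powr (3 - 2 * s))"
    using assms by (intro continuous_on_powr' continuous_on_id continuous_on_const) simp
  from continuous_on_mult_left[OF this, of "sgn (1/2 - s)"] show ?thesis
    using False by (simp add: riesz_deriv_def[abs_def])
next
  case True
  have "continuous (at y within {0..}) (riesz_deriv s 0)" if "y \<ge> 0" for y
  proof (cases "y = 0")
    case y: True
    have "((\<lambda>y::real. y\<^sup>2 * ln y) \<longlongrightarrow> 0) (at_right 0)" by real_asymp
    with y True show ?thesis
      by (simp add: continuous_within riesz_deriv_def[abs_def] at_within_Ici_at_right)
  next
    case False
    with that have "isCont (riesz_deriv s 0) y" by (intro DERIV_isCont[OF riesz_deriv_DERIV]) auto
    then show ?thesis by (rule continuous_at_imp_continuous_at_within)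
  qed
  then show ?thesis by (simp add: continuous_on_eq_continuous_within)
qed

text \<open>The falling factorial of \<open>3 - 2 s\<close> loses one sign at \<open>s = 1/2\<close>, which the sign in front of the power
undoes, and another one at \<open>s = 1\<close>. This is why \<open>s = 1\<close> separates the two regimes of the theorem.\<close>

lemma riesz_deriv_signs:
  assumes "y > 0"
  shows "0 < s \<Longrightarrow> s < 1 \<Longrightarrow> riesz_deriv s 3 y > 0"
    and "0 < s \<Longrightarrow> s < 1 \<Longrightarrow> riesz_deriv s 4 y < 0"
    and "1 < s \<Longrightarrow> s < 3/2 \<Longrightarrow> riesz_deriv s 3 y < 0"
    and "1 < s \<Longrightarrow> s < 3/2 \<Longrightarrow> riesz_deriv s 4 y > 0"
proof -
  have P: "(\<Prod>j<3. 3 - 2 * s - real j) = (3 - 2 * s) * (2 - 2 * s) * (1 - 2 * s)"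
    "(\<Prod>j<4. 3 - 2 * s - real j) = (3 - 2 * s) * (2 - 2 * s) * (1 - 2 * s) * (- 2 * s)"
    by (simp_all add: numeral_eq_Suc)
  show "riesz_deriv s 3 y > 0" if "0 < s" "s < 1"
    using assms that by (auto simp: riesz_deriv_def P sgn_if mult_less_0_iff zero_less_mult_iff)
  show "riesz_deriv s 4 y < 0" if "0 < s" "s < 1"
    using assms that by (auto simp: riesz_deriv_def P sgn_if mult_less_0_iff zero_less_mult_iff)
  show "riesz_deriv s 3 y < 0" if "1 < s" "s < 3/2"
    using assms that by (auto simp: riesz_deriv_def P sgn_if mult_less_0_iff zero_less_mult_iff)
  show "riesz_deriv s 4 y > 0" if "1 < s" "s < 3/2"
    using assms that by (auto simp: riesz_deriv_def P sgn_if mult_less_0_iff zero_less_mult_iff)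
qed

section \<open>Third and fourth differences on the integers\<close>

text \<open>Shifted so that consecutive values differ by a central fourth difference. At \<open>m = 0\<close> the nodes are
\<open>-1, 0, 1, 2\<close>, and the evenness of \<open>riesz\<close> halves the fourth difference at \<open>0\<close>.\<close>

definition third_diff :: "real \<Rightarrow> nat \<Rightarrow> real" where
  "third_diff s m = riesz s (real m + 2) - 3 * riesz s (real m + 1) + 3 * riesz s (real m) - riesz s (real m - 1)"

definition fourth_diff :: "real \<Rightarrow> nat \<Rightarrow> real" where
  "fourth_diff s p = riesz s (real p + 2) - 4 * riesz s (real p + 1) + 6 * riesz s (real p)
     - 4 * riesz s (real p - 1) + riesz s (real p - 2)"

lemma riesz_minus_1: "riesz s (-1) = riesz s 1" and riesz_minus_2: "riesz s (-2) = riesz s 2"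
  using riesz_minus[of s 1] riesz_minus[of s 2] by simp_all

lemma third_diff_0: "third_diff s 0 = riesz s 2 - 4 * riesz s 1"
  by (simp add: third_diff_def riesz_minus_1)

lemma fourth_diff_0: "fourth_diff s 0 = 2 * third_diff s 0"
  by (simp add: fourth_diff_def third_diff_0 riesz_minus_1 riesz_minus_2)

lemma fourth_diff_Suc: "fourth_diff s (Suc p) = third_diff s (Suc p) - third_diff s p"
  by (simp add: fourth_diff_def third_diff_def algebra_simps)

lemma third_diff_eq_forward_diff:
  assumes "m \<ge> 1"
  shows "third_diff s m = forward_diff 3 (riesz_deriv s 0) (real m - 1)"
proof -
  define y where "y = real m - 1"
  have y: "y \<ge> 0" "real m = y + 1" using assms by (simp_all add: y_def)
  show ?thesis
    unfolding y_def[symmetric] third_diff_def y(2) forward_diff_3 using y(1) by (simp add: riesz_eq_riesz_deriv algebra_simps)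
qed

lemma third_diff_Suc_eq_forward_diff:
  assumes "m \<ge> 1"
  shows "third_diff s (Suc m) - third_diff s m = forward_diff 4 (riesz_deriv s 0) (real m - 1)"
proof -
  define y where "y = real m - 1"
  have y: "y \<ge> 0" "real m = y + 1" "real (Suc m) = y + 2" using assms by (simp_all add: y_def)
  show ?thesis
    unfolding y_def[symmetric] third_diff_def y(2,3) forward_diff_4 using y(1) by (simp add: riesz_eq_riesz_deriv algebra_simps)
qed

lemma third_diff_mvt:
  assumes "m \<ge> 1" "s < 3/2"
  shows "\<exists>z>0. third_diff s m = riesz_deriv s 3 z"
proof -
  have "\<exists>z>real m - 1. forward_diff (Suc 2) (riesz_deriv s 0) (real m - 1) = riesz_deriv s (Suc 2) z"
    by (rule forward_diff_eq_derivative[where D = "riesz_deriv s", OF continuous_on_riesz_deriv_0[OF assms(2)]]) (use assms in \<open>simp_all add: riesz_deriv_DERIV\<close>)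
  then obtain z where z: "z > real m - 1" "forward_diff (Suc 2) (riesz_deriv s 0) (real m - 1) = riesz_deriv s (Suc 2) z"
    by blast
  have "z > 0" using z(1) assms(1) by linarith
  moreover have "Suc 2 = 3" by simp
  ultimately show ?thesis using z(2) by (intro exI[of _ z]) (simp only: third_diff_eq_forward_diff[OF assms(1)])
qed

lemma third_diff_Suc_mvt:
  assumes "m \<ge> 1" "s < 3/2"
  shows "\<exists>z>0. third_diff s (Suc m) - third_diff s m = riesz_deriv s 4 z"
proof -
  have "\<exists>z>real m - 1. forward_diff (Suc 3) (riesz_deriv s 0) (real m - 1) = riesz_deriv s (Suc 3) z"
    by (rule forward_diff_eq_derivative[where D = "riesz_deriv s", OF continuous_on_riesz_deriv_0[OF assms(2)]]) (use assms in \<open>simp_all add: riesz_deriv_DERIV\<close>)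
  then obtain z where z: "z > real m - 1" "forward_diff (Suc 3) (riesz_deriv s 0) (real m - 1) = riesz_deriv s (Suc 3) z"
    by blast
  have "z > 0" using z(1) assms(1) by linarith
  moreover have "Suc 3 = 4" by simp
  ultimately show ?thesis using z(2) by (intro exI[of _ z]) (simp only: third_diff_Suc_eq_forward_diff[OF assms(1)])
qed

text \<open>The value is \<open>2 powr (3 - 2 s) - 4\<close> times the sign of \<open>1/2 - s\<close>, and \<open>3 - 2 s\<close> passes \<open>2\<close> at \<open>s = 1/2\<close>;
there it is \<open>4 ln 2\<close>.\<close>

lemma third_diff_0_pos:
  assumes "0 < s" "s < 3/2" shows "third_diff s 0 > 0"
proof -
  consider "s < 1/2" | "s = 1/2" | "s > 1/2" by linarith
  then show ?thesis
  proof cases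
    case 1
    then have "2 powr (3 - 2 * s) > (2::real) powr 2" by (intro powr_less_mono) auto
    with 1 show ?thesis by (simp add: third_diff_0 riesz_def)
  next
    case 2
    then show ?thesis by (simp add: third_diff_0 riesz_def)
  next
    case 3
    then have "2 powr (3 - 2 * s) < (2::real) powr 2" by (intro powr_less_mono) auto
    with 3 show ?thesis by (simp add: third_diff_0 riesz_def)
  qed
qed

lemma third_diff_pos:
  assumes "0 < s" "s < 1" shows "third_diff s m > 0"
proof (cases "m = 0")
  case True
  then show ?thesis using third_diff_0_pos assms by simp
next
  case False
  then have "m \<ge> 1" "s < 3/2" using assms by simp_all
  from third_diff_mvt[OF this] obtain z where z: "z > 0" "third_diff s m = riesz_deriv s 3 z" by blast
  show ?thesis unfolding z(2) by (rule riesz_deriv_signs(1)[OF z(1) assms])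
qed

lemma third_diff_neg:
  assumes "1 < s" "s < 3/2" "m \<ge> 1" shows "third_diff s m < 0"
proof -
  from third_diff_mvt[OF assms(3,2)] obtain z where z: "z > 0" "third_diff s m = riesz_deriv s 3 z" by blast
  show ?thesis unfolding z(2) by (rule riesz_deriv_signs(3)[OF z(1) assms(1,2)])
qed

lemma third_diff_Suc_less:
  assumes "0 < s" "s < 1" "m \<ge> 1" shows "third_diff s (Suc m) < third_diff s m"
proof -
  have "s < 3/2" using assms by simp
  from third_diff_Suc_mvt[OF assms(3) this] obtain z
    where z: "z > 0" "third_diff s (Suc m) - third_diff s m = riesz_deriv s 4 z" by blast
  then show ?thesis using riesz_deriv_signs(2)[OF z(1) assms(1,2)] by linarith
qed

lemma third_diff_Suc_greater:
  assumes "1 < s" "s < 3/2" "m \<ge> 1" shows "third_diff s (Suc m) > third_diff s m"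
proof -
  from third_diff_Suc_mvt[OF assms(3,2)] obtain z
    where z: "z > 0" "third_diff s (Suc m) - third_diff s m = riesz_deriv s 4 z" by blast
  then show ?thesis using riesz_deriv_signs(4)[OF z(1) assms(1,2)] by linarith
qed

section \<open>The function t1 and its root s0\<close>

text \<open>Strictly convex functions lie strictly below the larger of two values in between. Otherwise the
mean value theorem gives a nonnegative slope to the left of \<open>x\<close> and a nonpositive one to the right.\<close>

lemma less_max_if_deriv_strict_mono:
  fixes g g' :: "real \<Rightarrow> real"
  assumes "\<And>z. (g has_real_derivative g' z) (at z)" "strict_mono g'"
    and "u < x" "x < v" "g u \<le> c" "g v \<le> c"
  shows "g x < c"
proof (rule ccontr)
  assume "\<not> g x < c"
  obtain z1 where z1: "z1 < x" "g x - g u = (x - u) * g' z1"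
    using MVT2[of u x g g'] assms by blast
  obtain z2 where z2: "z2 > x" "g v - g x = (v - x) * g' z2"
    using MVT2[of x v g g'] assms by blast
  from z1(2) z2(2) have "g' z1 \<ge> 0" "g' z2 \<le> 0"
    using assms(3-6) \<open>\<not> g x < c\<close>
    by (smt (verit) zero_le_mult_iff mult_pos_pos)+
  moreover have "g' z1 < g' z2" using z1(1) z2(1) assms(2) by (simp add: strict_mono_def)
  ultimately show False by linarith
qed

text \<open>Dividing \<open>A + 3 powr x - c * 2 powr x\<close> by \<open>2 powr x\<close> turns a sum of exponentials with mixed signs into this
convex function; the linear term serves to compare it with a chord.\<close>

definition exp_pair :: "real \<Rightarrow> real \<Rightarrow> real \<Rightarrow> real" where
  "exp_pair A l x = A * 2 powr (- x) + (3/2) powr x - l * x"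

lemma exp_pair_less:
  assumes "A \<ge> 0" "u < x" "x < v" "exp_pair A l u \<le> c" "exp_pair A l v \<le> c"
  shows "exp_pair A l x < c"
proof (rule less_max_if_deriv_strict_mono[OF _ _ assms(2-5)])
  let ?g' = "\<lambda>x::real. ln (3/2) * (3/2) powr x - A * ln 2 * 2 powr (- x) - l"
  show "(exp_pair A l has_real_derivative ?g' z) (at z)" for z
    unfolding exp_pair_def[abs_def] by (auto intro!: derivative_eq_intros)
  show "strict_mono ?g'"
  proof (rule strict_monoI)
    fix x y :: real assume "x < y"
    then have "(3/2) powr x < (3/2 :: real) powr y" "2 powr (- y) < (2::real) powr (- x)"
      by (auto intro: powr_less_mono)
    then have "ln (3/2) * (3/2) powr x < ln (3/2) * (3/2 :: real) powr y"
      "A * ln 2 * 2 powr (- y) \<le> A * ln 2 * 2 powr (- x)"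
      using assms(1) by (auto intro!: mult_left_mono)
    then show "?g' x < ?g' y" by linarith
  qed
qed

lemma exp_pair_2: "exp_pair A l 2 = A / 4 + 9/4 - 2 * l" and exp_pair_3: "exp_pair A l 3 = A / 8 + 27/8 - 3 * l"
  by (simp_all add: exp_pair_def powr_minus field_simps)

lemma two_powr_exp_pair: "2 powr x * exp_pair A l x = A + 3 powr x - l * x * 2 powr x"
proof -
  have "2 powr x * (3/2) powr x = (3::real) powr x"
    by (simp add: powr_divide)
  moreover have "2 powr x * 2 powr (- x) = (1::real)" by (simp add: powr_minus)
  ultimately show ?thesis by (simp add: exp_pair_def algebra_simps)
qed

lemma t1_eq: "t1 s = 7 + 3 powr (3 - 2 * s) - 4 * 2 powr (3 - 2 * s)"
proof -
  have "2 powr (5 - 2 * s) = 2 powr (2 + (3 - 2 * s))" by (simp add: algebra_simps)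
  also have "\<dots> = 4 * (2::real) powr (3 - 2 * s)" by (subst powr_add) simp
  finally show ?thesis by (simp add: t1_def)
qed

lemma t1_eq_exp_pair: "t1 s = 2 powr (3 - 2 * s) * (exp_pair 7 0 (3 - 2 * s) - 4)"
  by (simp add: t1_eq right_diff_distrib two_powr_exp_pair)

text \<open>Rational powers are compared with rationals through integer powers, which are decided by computation.\<close>

lemma root_powr:
  assumes "x > (0::real)" "q > 0"
  shows "(x powr (real p / real q)) ^ q = x ^ p"
proof -
  have "(x powr (real p / real q)) ^ q = x powr (real p / real q * real q)"
    using assms(1) by (simp add: powr_powr flip: powr_realpow)
  then show ?thesis using assms by (simp add: powr_realpow)
qed

lemma powr_rational_less:
  fixes x u :: real
  assumes "x > 0" "u > 0" "q > 0" "x ^ p < u ^ q"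
  shows "x powr (real p / real q) < u"
proof -
  have "(x powr (real p / real q)) ^ q < u ^ q" using assms by (simp add: root_powr)
  with \<open>u > 0\<close> show ?thesis by (meson less_imp_le power_less_imp_less_base)
qed

lemma powr_rational_greater:
  fixes x u :: real
  assumes "x > 0" "q > 0" "u ^ q < x ^ p"
  shows "u < x powr (real p / real q)"
proof -
  have "u ^ q < (x powr (real p / real q)) ^ q" using assms by (simp add: root_powr)
  then show ?thesis by (rule power_less_imp_less_base) simp
qed

text \<open>Rounding after each fourth power keeps the numbers in \<open>t1_bracket\<close> short enough to be computed with.\<close>

lemma power_ge_rounded:
  fixes u :: real
  assumes "0 \<le> u" "0 \<le> a" "0 \<le> c" "a \<le> u ^ 4" "c \<le> a ^ 4"
  shows "c ^ k * u ^ r \<le> u ^ (16 * k + r)"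
proof -
  have "c \<le> (u ^ 4) ^ 4" using assms power_mono[of a "u ^ 4" 4] by linarith
  then have "c ^ k * u ^ r \<le> ((u ^ 4) ^ 4) ^ k * u ^ r"
    using assms by (intro mult_right_mono power_mono) auto
  then show ?thesis by (simp add: power_add flip: power_mult)
qed

lemma power_le_rounded:
  fixes u :: real
  assumes "0 \<le> u" "u ^ 4 \<le> a" "a ^ 4 \<le> c"
  shows "u ^ (16 * k + r) \<le> c ^ k * u ^ r"
proof -
  have "(u ^ 4) ^ 4 \<le> c" using assms power_mono[of "u ^ 4" a 4] by fastforce
  then have "((u ^ 4) ^ 4) ^ k * u ^ r \<le> c ^ k * u ^ r"
    using assms by (intro mult_right_mono power_mono) auto
  then show ?thesis by (simp add: power_add flip: power_mult)
qed

text \<open>Here \<open>3 - 2 s\<close> is \<open>250/99\<close> and \<open>351/139\<close>, rationals with small denominators that enclose the root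
tightly enough for four digits of \<open>s0\<close>. The decimals are bounds for \<open>2 powr (3 - 2 s)\<close> and
\<open>3 powr (3 - 2 s)\<close>.\<close>

lemma t1_bracket:
  shows "t1 (47/198) > 0" and "t1 (33/139) < 0"
proof -
  have "(2::real) ^ 250 < 1454887650000 ^ 6 * 5.756743 ^ 3" by (simp add: power_divide)
  also have "\<dots> \<le> 5.756743 ^ (16 * 6 + 3)"
    by (rule power_ge_rounded[where a = "1098.26556"]) (simp_all add: power_divide)
  finally have "2 powr (real 250 / real 99) < (5.756743 :: real)" by (intro powr_rational_less) auto
  moreover have "18950686800000000000 ^ 6 * 16.026975 ^ 3 < (3::real) ^ 250" by (simp add: power_divide)
  then have "(16.026975::real) ^ (16 * 6 + 3) < 3 ^ 250"
    by (rule order.strict_trans1[rotated])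
       (rule power_le_rounded[where a = "65979.07733"], simp_all add: power_divide)
  then have "3 powr (real 250 / real 99) > (16.026975 :: real)" by (intro powr_rational_greater) auto
  ultimately show "t1 (47/198) > 0" by (simp add: t1_eq)
  have "(5.75645::real) ^ (16 * 8 + 11) \<le> 1453703360000 ^ 8 * 5.75645 ^ 11"
    by (rule power_le_rounded[where a = "1098.04199"]) (simp_all add: power_divide)
  also have "\<dots> < 2 ^ 351" by (simp add: power_divide)
  finally have "2 powr (real 351 / real 139) > (5.75645 :: real)" by (intro powr_rational_greater) auto
  moreover have "(3::real) ^ 351 < 18926579600000000000 ^ 8 * 16.0257 ^ 11" by (simp add: power_divide)
  then have "3 ^ 351 < (16.0257::real) ^ (16 * 8 + 11)"
    by (rule order.strict_trans2) (rule power_ge_rounded[where a = "65958.08439"], simp_all add: power_divide)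
  then have "3 powr (real 351 / real 139) < (16.0257 :: real)" by (intro powr_rational_less) auto
  ultimately show "t1 (33/139) < 0" by (simp add: t1_eq)
qed

text \<open>With \<open>x = 3 - 2 s\<close>, the sign of \<open>t1 s\<close> is that of the strictly convex \<open>exp_pair 7 0 x - 4\<close>, which vanishes
at \<open>x = 2\<close> and at the root found by the intermediate value theorem: negative between its two zeros,
positive outside.\<close>

lemma t1_root:
  obtains r where "47/198 < r" "r < 33/139" "t1 r = 0"
    "\<And>s. s < r \<Longrightarrow> t1 s > 0" "\<And>s. r < s \<Longrightarrow> s < 1/2 \<Longrightarrow> t1 s < 0" "\<And>s. 1/2 < s \<Longrightarrow> t1 s > 0"
proof -
  have cont: "continuous_on A t1" for A
    unfolding t1_def[abs_def] by (intro continuous_intros) auto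
  have "\<exists>r\<ge>47/198. r \<le> 33/139 \<and> t1 r = 0"
    by (rule IVT2') (use t1_bracket cont in auto)
  then obtain r where r: "r \<ge> 47/198" "r \<le> 33/139" "t1 r = 0" by blast
  have neq: "r \<noteq> 47/198" "r \<noteq> 33/139" using r(3) t1_bracket by (metis order_less_irrefl)+
  have a4: "exp_pair 7 0 (3 - 2 * r) = 4" using r(3) by (simp add: t1_eq_exp_pair)
  have pos: "t1 s > 0 \<longleftrightarrow> exp_pair 7 0 (3 - 2 * s) > 4" "t1 s < 0 \<longleftrightarrow> exp_pair 7 0 (3 - 2 * s) < 4" for s
    by (simp_all add: t1_eq_exp_pair zero_less_mult_iff mult_less_0_iff)
  have "t1 s > 0" if "s < r" for s
  proof (rule ccontr)
    assume "\<not> t1 s > 0"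
    then have "exp_pair 7 0 (3 - 2 * r) < 4"
      by (intro exp_pair_less[of 7 2 _ "3 - 2 * s"]) (use that r(2) pos in \<open>auto simp: exp_pair_2\<close>)
    with a4 show False by simp
  qed
  moreover have "t1 s < 0" if "r < s" "s < 1/2" for s
    unfolding pos by (intro exp_pair_less[of 7 2 _ "3 - 2 * r"]) (use that a4 in \<open>auto simp: exp_pair_2\<close>)
  moreover have "t1 s > 0" if "1/2 < s" for s
  proof (rule ccontr)
    assume "\<not> t1 s > 0"
    then have "exp_pair 7 0 2 < 4"
      by (intro exp_pair_less[of 7 "3 - 2 * s" _ "3 - 2 * r"]) (use that r(2) a4 pos in auto)
    then show False by (simp add: exp_pair_2)
  qed
  ultimately show ?thesis using r neq by (intro that[of r]) auto
qed

lemma ex1_t1_root: "\<exists>!s. 0 < s \<and> s < 1/2 \<and> t1 s = 0"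
proof -
  obtain r where r: "47/198 < r" "r < 33/139" "t1 r = 0"
    "\<And>s. s < r \<Longrightarrow> t1 s > 0" "\<And>s. r < s \<Longrightarrow> s < 1/2 \<Longrightarrow> t1 s < 0" "\<And>s. 1/2 < s \<Longrightarrow> t1 s > 0"
    by (rule t1_root) blast
  show ?thesis
  proof (rule ex1I[of _ r])
    show "0 < r \<and> r < 1/2 \<and> t1 r = 0" using r by auto
    show "s = r" if "0 < s \<and> s < 1/2 \<and> t1 s = 0" for s
      using that r(4,5)[of s] by (cases s r rule: linorder_cases) auto
  qed
qed

lemma s0_root: "0 < s0" "s0 < 1/2" "t1 s0 = 0"
  using theI'[OF ex1_t1_root] unfolding s0_def by auto

lemma s0_props:
  shows "\<bar>s0 - 0.2374\<bar> < 0.00005" and "s0 < 1/4"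
    and "s < s0 \<Longrightarrow> t1 s > 0" and "s0 < s \<Longrightarrow> s < 1/2 \<Longrightarrow> t1 s < 0" and "1/2 < s \<Longrightarrow> t1 s > 0"
proof -
  obtain r where r: "47/198 < r" "r < 33/139" "t1 r = 0"
    "\<And>s. s < r \<Longrightarrow> t1 s > 0" "\<And>s. r < s \<Longrightarrow> s < 1/2 \<Longrightarrow> t1 s < 0" "\<And>s. 1/2 < s \<Longrightarrow> t1 s > 0"
    by (rule t1_root) blast
  have "s0 = r" using ex1_t1_root s0_root r by (metis (no_types, lifting) order_less_irrefl linorder_neqE_linordered_idom)
  with r have "s0 - 0.2374 < 0.00005" "- (s0 - 0.2374) < 0.00005" by auto
  then show "\<bar>s0 - 0.2374\<bar> < 0.00005" by (rule abs_less_iff[THEN iffD2, OF conjI])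
  show "s0 < 1/4" "s < s0 \<Longrightarrow> t1 s > 0" "s0 < s \<Longrightarrow> s < 1/2 \<Longrightarrow> t1 s < 0"
    "1/2 < s \<Longrightarrow> t1 s > 0"
    using r \<open>s0 = r\<close> by auto
qed

text \<open>At \<open>s = 0\<close> and \<open>s = 1/2\<close> the corresponding \<open>exp_pair\<close> does not exceed \<open>4\<close>; convexity does the rest.\<close>

lemma t1_less_2:
  assumes "0 < s" "s < 1/2" shows "t1 s < 2"
proof -
  have "exp_pair 5 0 (3 - 2 * s) < 4" by (rule exp_pair_less[of _ 2 _ 3]) (use assms in \<open>auto simp: exp_pair_2 exp_pair_3\<close>)
  then have "2 powr (3 - 2 * s) * exp_pair 5 0 (3 - 2 * s) < 2 powr (3 - 2 * s) * 4" by simp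
  then show ?thesis by (simp add: two_powr_exp_pair t1_eq)
qed

text \<open>The right-hand side is \<open>third_diff s 0\<close>. This makes the first and last rows dominant for every \<open>N\<close>; both
sides agree at \<open>s = 0\<close> and at \<open>s = 1/2\<close>, and convexity gives strictness in between.\<close>

lemma two_t1_less:
  assumes "0 < s" "s < 1/2" shows "2 * t1 s < 2 powr (3 - 2 * s) - 4"
proof -
  have "exp_pair 9 0 (3 - 2 * s) < 9/2" by (rule exp_pair_less[of _ 2 _ 3]) (use assms in \<open>auto simp: exp_pair_2 exp_pair_3\<close>)
  then have "2 powr (3 - 2 * s) * exp_pair 9 0 (3 - 2 * s) < 2 powr (3 - 2 * s) * (9/2)" by simp
  then show ?thesis by (simp add: two_powr_exp_pair t1_eq)
qed

text \<open>Bernoulli's inequality for exponents in the unit interval.\<close>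

lemma powr_le_affine:
  fixes u b :: real
  assumes "u > 0" "0 \<le> b" "b \<le> 1"
  shows "u powr b \<le> 1 + b * (u - 1)"
  using Youngs_inequality_0[of b "1 - b" u 1] assms by (simp add: algebra_simps)

text \<open>It says that \<open>N0 s\<close> is at least \<open>3\<close>, so that \<open>N \<ge> N0 s + 3\<close> forces \<open>N \<ge> 6\<close> and the middle row has at
least two entries on either side. Both \<open>t1\<close> (through \<open>exp_pair\<close>) and \<open>2 powr x\<close> are bounded by chords over \<open>[2, 3]\<close>.\<close>

lemma t1_gam_bound:
  assumes "0 < s" "s < 1/4" shows "t1 s * (3/2) powr (2 * s) \<le> gam s"
proof -
  define x where "x = 3 - 2 * s"
  have x: "5/2 < x" "x < 3" using assms by (auto simp: x_def)
  have "2 powr (x - 2) \<le> 1 + (x - 2) * (2 - 1 :: real)"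
    by (rule powr_le_affine) (use x in auto)
  moreover have "(2::real) powr x = 2 powr 2 * 2 powr (x - 2)" by (subst powr_add[symmetric]) simp
  ultimately have p: "2 powr x \<le> 4 * (x - 1)" by simp
  have "exp_pair 7 (1/4) x < 7/2" by (rule exp_pair_less[of _ 2 _ 3]) (use x in \<open>auto simp: exp_pair_2 exp_pair_3\<close>)
  then have "exp_pair 7 0 x - 4 \<le> (x - 2) / 4" by (simp add: exp_pair_def)
  then have "t1 s \<le> 2 powr x * ((x - 2) / 4)"
    unfolding t1_eq_exp_pair x_def[symmetric] by (intro mult_left_mono) auto
  also have "\<dots> \<le> (4 * (x - 1)) * ((x - 2) / 4)" by (intro mult_right_mono p) (use x in auto)
  also have "\<dots> = (x - 1) * (x - 2)" by (simp add: field_simps)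
  finally have t: "t1 s \<le> (x - 1) * (x - 2)" .
  have b: "(3/2) powr (2 * s) \<le> 1 + (2 * s) * (3/2 - 1 :: real)"
    by (rule powr_le_affine) (use assms in auto)
  also have "\<dots> = (5 - x) / 2" by (simp add: x_def)
  also have "\<dots> \<le> x / 2" using x by simp
  finally have b: "(3/2) powr (2 * s) \<le> x / 2" .
  have "t1 s * (3/2) powr (2 * s) \<le> ((x - 1) * (x - 2)) * (3/2) powr (2 * s)"
    by (intro mult_right_mono t) auto
  also have "\<dots> \<le> ((x - 1) * (x - 2)) * (x / 2)" by (intro mult_left_mono b) (use x in auto)
  also have "\<dots> = gam s" by (simp add: gam_def x_def field_simps)
  finally show ?thesis .
qed

section \<open>Sharp bounds for third differences, s < 1/2\<close>

lemma nondecreasing_if_deriv_nonneg: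
  fixes f f' :: "real \<Rightarrow> real"
  assumes "a \<le> b" "\<And>x. a \<le> x \<Longrightarrow> x \<le> b \<Longrightarrow> (f has_real_derivative f' x) (at x)"
    and "\<And>x. a \<le> x \<Longrightarrow> x \<le> b \<Longrightarrow> f' x \<ge> 0"
  shows "f a \<le> f b"
  using assms by (intro DERIV_nonneg_imp_nondecreasing[of a b f]) blast+

lemma riesz_deriv_3:
  assumes "0 < s" "s < 1/2" shows "riesz_deriv s 3 y = 2 * gam s * y powr (- 2 * s)"
  using assms by (simp add: riesz_deriv_def gam_def eval_nat_numeral algebra_simps)

lemma gam_pos: "0 < s \<Longrightarrow> s < 1/2 \<Longrightarrow> gam s > 0"
  by (simp add: gam_def)

lemma riesz_deriv_5_pos:
  assumes "0 < s" "s < 1/2" "y > 0" shows "riesz_deriv s 5 y > 0"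
proof -
  have "(\<Prod>j<5. 3 - 2 * s - real j) = (3 - 2 * s) * (2 - 2 * s) * (1 - 2 * s) * (- 2 * s) * (- 1 - 2 * s)"
    by (simp add: numeral_eq_Suc)
  also have "\<dots> > 0" using assms by (auto simp: zero_less_mult_iff mult_less_0_iff)
  finally show ?thesis using assms by (simp add: riesz_deriv_def)
qed

lemma convex_riesz_deriv_3:
  assumes "0 < s" "s < 1/2" shows "convex_on {0<..} (riesz_deriv s 3)"
proof (rule f''_ge0_imp_convex[where f' = "riesz_deriv s 4" and f'' = "riesz_deriv s 5"])
  show "(riesz_deriv s 3 has_real_derivative riesz_deriv s 4 x) (at x)" if "x \<in> {0<..}" for x
    using riesz_deriv_DERIV[of x s 3] that assms by simp
  show "(riesz_deriv s 4 has_real_derivative riesz_deriv s 5 x) (at x)" if "x \<in> {0<..}" for x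
    using riesz_deriv_DERIV[of x s 4] that assms by simp
  show "riesz_deriv s 5 x \<ge> 0" if "x \<in> {0<..}" for x
    using riesz_deriv_5_pos[of s x] that assms by simp
qed simp

lemma convex_on_midpoint:
  fixes f :: "real \<Rightarrow> real"
  assumes "convex_on C f" "x \<in> C" "y \<in> C"
  shows "2 * f ((x + y) / 2) \<le> f x + f y"
  using convex_onD[OF assms(1), of "1/2" x y] assms(2,3) by (simp add: field_simps)

lemma riesz_deriv_DERIV_shift:
  assumes "0 < s" "s < 1/2" "x + c > 0"
  shows "((\<lambda>x. riesz_deriv s i (x + c)) has_real_derivative riesz_deriv s (Suc i) (x + c)) (at x)"
  using riesz_deriv_DERIV[of "x + c" s i] assms by (simp add: DERIV_shift)

text \<open>A central second difference of \<open>\<Phi>'\<close> dominates its second derivative, because \<open>\<Phi>'''\<close> is convex: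
after two differentiations in the step size the claim becomes midpoint convexity.\<close>

lemma second_diff_ge:
  assumes s: "0 < s" "s < 1/2" and "z > 0"
  shows "riesz_deriv s 3 (z + 1) \<le> riesz_deriv s 1 (z + 2) - 2 * riesz_deriv s 1 (z + 1) + riesz_deriv s 1 z"
proof -
  define c where "c = z + 1"
  have c: "c > 1" using \<open>z > 0\<close> by (simp add: c_def)
  have D: "((\<lambda>t. riesz_deriv s i (c + t)) has_real_derivative riesz_deriv s (Suc i) (c + t)) (at t)"
    "((\<lambda>t. riesz_deriv s i (c - t)) has_real_derivative - riesz_deriv s (Suc i) (c - t)) (at t)"
    if "0 \<le> t" "t \<le> 1" for t i
  proof -
    have "(riesz_deriv s i has_real_derivative riesz_deriv s (Suc i) (c + t)) (at (c + t))"
      "(riesz_deriv s i has_real_derivative riesz_deriv s (Suc i) (c - t)) (at (c - t))"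
      using that c s by (auto intro!: riesz_deriv_DERIV)
    note c = this
    have inner: "((\<lambda>t. c + t) has_real_derivative 1) (at t)" "((\<lambda>t. c - t) has_real_derivative -1) (at t)"
      by (auto intro!: derivative_eq_intros)
    show "((\<lambda>t. riesz_deriv s i (c + t)) has_real_derivative riesz_deriv s (Suc i) (c + t)) (at t)"
      using DERIV_chain2[of "riesz_deriv s i" _ "\<lambda>t. c + t" t 1 UNIV, OF c(1) inner(1)] by simp
    show "((\<lambda>t. riesz_deriv s i (c - t)) has_real_derivative - riesz_deriv s (Suc i) (c - t)) (at t)"
      using DERIV_chain2[of "riesz_deriv s i" _ "\<lambda>t. c - t" t "-1" UNIV, OF c(2) inner(2)] by simp
  qed
  \<comment> \<open>The second difference with step \<open>t\<close>, up to a constant, minus its expected value \<open>t\<^sup>2 \<Phi>''' (c)\<close>; the claim compares \<open>t = 0\<close> with \<open>t = 1\<close>.\<close>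
  let ?F = "\<lambda>t. riesz_deriv s 1 (c + t) + riesz_deriv s 1 (c - t) - t\<^sup>2 * riesz_deriv s 3 c"
  let ?F' = "\<lambda>t. riesz_deriv s 2 (c + t) - riesz_deriv s 2 (c - t) - 2 * t * riesz_deriv s 3 c"
  let ?F'' = "\<lambda>t. riesz_deriv s 3 (c + t) + riesz_deriv s 3 (c - t) - 2 * riesz_deriv s 3 c"
  have S: "Suc 1 = 2" "Suc 2 = 3" by simp_all
  have F: "(?F has_real_derivative ?F' t) (at t)" if "0 \<le> t" "t \<le> 1" for t
    using D[OF that, of 1] unfolding S by (auto intro!: derivative_eq_intros)
  have F': "(?F' has_real_derivative ?F'' t) (at t)" if "0 \<le> t" "t \<le> 1" for t
    using D[OF that, of 2] unfolding S by (auto intro!: derivative_eq_intros)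
  have F'': "?F'' t \<ge> 0" if "0 \<le> t" "t \<le> 1" for t
    using convex_on_midpoint[OF convex_riesz_deriv_3[OF s], of "c + t" "c - t"] that c by simp
  have "?F' t \<ge> 0" if "0 \<le> t" "t \<le> 1" for t
  proof -
    have "?F' 0 \<le> ?F' t"
      by (rule nondecreasing_if_deriv_nonneg[OF that(1), where f' = ?F'']) (use that F' F'' in auto)
    then show ?thesis by simp
  qed
  then have "?F 0 \<le> ?F 1"
    by (intro nondecreasing_if_deriv_nonneg[of 0 1 ?F ?F']) (use F in auto)
  then show ?thesis by (simp add: c_def algebra_simps)
qed

text \<open>Writing \<open>third_diff s m\<close> as an increment of a second difference, the mean value theorem gives the second
difference of \<open>\<Phi>'\<close> centred at some \<open>z + 1 < m + 1\<close>; there \<open>\<Phi>'''\<close> is already larger than at \<open>m + 1\<close>. For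
\<open>m = 1\<close> the nodes start at \<open>0\<close>, where \<open>\<Phi>\<close> enters only through its continuity.\<close>

lemma third_diff_gt:
  assumes s: "0 < s" "s < 1/2" and "m \<ge> 1"
  shows "riesz_deriv s 3 (real m + 1) < third_diff s m"
proof -
  define y where "y = real m - 1"
  have y: "y \<ge> 0" using assms by (simp add: y_def)
  define D where "D i x = riesz_deriv s i (x + 2) - 2 * riesz_deriv s i (x + 1) + riesz_deriv s i x" for i x
  have cont: "continuous_on {0..} (riesz_deriv s 0)" by (rule continuous_on_riesz_deriv_0) (use s in auto)
  have "continuous_on {y..y + 1} (D 0)"
    unfolding D_def using y
    by (intro continuous_intros continuous_on_compose2[OF cont]) auto
  moreover have D': "(D 0 has_real_derivative D 1 x) (at x)" if "x > y" for x
    using riesz_deriv_DERIV_shift[of s x 2 0] riesz_deriv_DERIV_shift[of s x 1 0] riesz_deriv_DERIV_shift[of s x 0 0] that y s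
    unfolding D_def by (auto intro!: derivative_eq_intros)
  ultimately obtain l z where z: "y < z" "z < y + 1" "DERIV (D 0) z :> l" "D 0 (y + 1) - D 0 y = l"
    using MVT[of y "y + 1" "D 0"] by (force simp: real_differentiable_def)
  have "l = D 1 z" using D'[OF z(1)] z(3) DERIV_unique by blast
  moreover have "third_diff s m = D 0 (y + 1) - D 0 y"
    unfolding third_diff_eq_forward_diff[OF assms(3)] forward_diff_3 y_def[symmetric] D_def by (simp add: algebra_simps)
  moreover have "riesz_deriv s 3 (z + 1) \<le> D 1 z"
    unfolding D_def by (rule second_diff_ge) (use s z y in auto)
  moreover have "riesz_deriv s 3 (real m + 1) < riesz_deriv s 3 (z + 1)"
    unfolding riesz_deriv_3[OF s] using z y s gam_pos[OF s]
    by (intro mult_strict_left_mono powr_less_mono2_neg) (auto simp: y_def)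
  ultimately show ?thesis using z(4) by linarith
qed

text \<open>The trapezoidal rule overestimates the integral of a convex function.\<close>

lemma trapezoid_ge_increment:
  fixes g g' :: "real \<Rightarrow> real"
  assumes "\<And>x. y \<le> x \<Longrightarrow> x \<le> y + 1 \<Longrightarrow> (g has_real_derivative g' x) (at x)"
    and "convex_on {y..y + 1} g'"
  shows "g (y + 1) - g y \<le> (g' y + g' (y + 1)) / 2"
proof -
  let ?h = "\<lambda>x. (x - y) * g' y + (x - y)\<^sup>2 / 2 * (g' (y + 1) - g' y) - g x"
  let ?h' = "\<lambda>x. g' y + (x - y) * (g' (y + 1) - g' y) - g' x"
  have "(?h has_real_derivative ?h' x) (at x)" if "y \<le> x" "x \<le> y + 1" for x
    by (rule derivative_eq_intros assms(1)[OF that] refl | simp)+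
  moreover have "?h' x \<ge> 0" if "y \<le> x" "x \<le> y + 1" for x
    using convex_onD[OF assms(2), of "x - y" y "y + 1"] that by (simp add: algebra_simps)
  ultimately have "?h y \<le> ?h (y + 1)"
    by (intro nondecreasing_if_deriv_nonneg[of y "y + 1" ?h ?h']) auto
  then show ?thesis by (simp add: field_simps)
qed

text \<open>Three applications of the trapezoidal rule, one for each difference, give binomial weights on the nodes.
They are legitimate since \<open>\<Phi>'''\<close> and the first difference of \<open>\<Phi>''\<close> and the second difference of \<open>\<Phi>'\<close>
are convex.\<close>

lemma third_diff_le:
  assumes s: "0 < s" "s < 1/2" and "m \<ge> 2"
  shows "third_diff s m \<le> gam s / 4 * ((real m - 1) powr (- 2 * s) + 3 * real m powr (- 2 * s)
      + 3 * (real m + 1) powr (- 2 * s) + (real m + 2) powr (- 2 * s))"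
proof -
  define y where "y = real m - 1"
  have y: "y > 0" using assms by (simp add: y_def)
  define P where "P i x = riesz_deriv s i (x + 1) - riesz_deriv s i x" for i x
  define Q where "Q i x = P i (x + 1) - P i x" for i x
  have dP: "(P i has_real_derivative P (Suc i) x) (at x)" if "x > 0" for i x
    using riesz_deriv_DERIV_shift[of s x 1 i] riesz_deriv_DERIV_shift[of s x 0 i] that s
    unfolding P_def by (auto intro!: derivative_eq_intros)
  have dQ: "(Q i has_real_derivative Q (Suc i) x) (at x)" if "x > 0" for i x
  proof -
    have "((\<lambda>x. P i (x + 1)) has_real_derivative P (Suc i) (x + 1)) (at x)"
      using dP[of "x + 1" i] that by (simp add: DERIV_shift)
    then show ?thesis unfolding Q_def using dP[OF that, of i] by (intro DERIV_diff)
  qed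
  have P4: "P 4 x \<ge> 0" if "x > 0" for x
  proof -
    have "riesz_deriv s 4 x \<le> riesz_deriv s 4 (x + 1)"
    proof (rule nondecreasing_if_deriv_nonneg[where f = "riesz_deriv s 4" and f' = "riesz_deriv s 5"])
      show "(riesz_deriv s 4 has_real_derivative riesz_deriv s 5 t) (at t)" "riesz_deriv s 5 t \<ge> 0"
        if "x \<le> t" "t \<le> x + 1" for t
        using riesz_deriv_5_pos[OF s, of t] riesz_deriv_DERIV[of t s 4] s \<open>x > 0\<close> that by simp_all
    qed simp
    then show ?thesis by (simp add: P_def)
  qed
  have Q3: "Q 3 x \<ge> 0" if "x > 0" for x
    using convex_on_midpoint[OF convex_riesz_deriv_3[OF s], of x "x + 2"] that
    by (simp add: Q_def P_def algebra_simps add_divide_distrib)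
  have numS: "Suc 0 = 1" "Suc 1 = 2" "Suc 2 = 3" "Suc 3 = 4" by simp_all
  have conv: "convex_on {x..x + 1} (riesz_deriv s 3)" if "x > 0" for x
    by (rule convex_on_subset[OF convex_riesz_deriv_3[OF s]]) (use that in auto)
  have convP: "convex_on {x..x + 1} (P 2)" if "x > 0" for x
    by (rule f''_ge0_imp_convex[where f' = "P 3" and f'' = "P 4"])
       (use dP[of _ 2, unfolded numS] dP[of _ 3, unfolded numS] P4 that in auto)
  have convQ: "convex_on {x..x + 1} (Q 1)" if "x > 0" for x
    by (rule f''_ge0_imp_convex[where f' = "Q 2" and f'' = "Q 3"])
       (use dQ[of _ 1, unfolded numS] dQ[of _ 2, unfolded numS] Q3 that in auto)
  have 1: "P 2 x \<le> (riesz_deriv s 3 x + riesz_deriv s 3 (x + 1)) / 2" if "x > 0" for x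
    unfolding P_def
    by (rule trapezoid_ge_increment[OF _ conv[OF that]]) (use riesz_deriv_DERIV[of _ s 2] s that in auto)
  have 2: "Q 1 x \<le> (P 2 x + P 2 (x + 1)) / 2" if "x > 0" for x
    unfolding Q_def
    by (rule trapezoid_ge_increment[OF _ convP[OF that]]) (use dP[of _ 1, unfolded numS] that in auto)
  have "third_diff s m = Q 0 (y + 1) - Q 0 y"
  proof -
    have "third_diff s m = forward_diff 3 (riesz_deriv s 0) y"
      unfolding y_def by (rule third_diff_eq_forward_diff) (use assms in simp)
    then show ?thesis by (simp add: forward_diff_3 Q_def P_def algebra_simps)
  qed
  also have "\<dots> \<le> (Q 1 y + Q 1 (y + 1)) / 2"
    by (rule trapezoid_ge_increment[OF _ convQ[OF y]]) (use dQ[of _ 0, unfolded numS] y in auto)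
  also have "\<dots> \<le> (P 2 y + 2 * P 2 (y + 1) + P 2 (y + 2)) / 4"
    using 2[of y] 2[of "y + 1"] y by (simp add: add.assoc field_simps)
  also have "\<dots> \<le> (riesz_deriv s 3 y + 3 * riesz_deriv s 3 (y + 1) + 3 * riesz_deriv s 3 (y + 2) + riesz_deriv s 3 (y + 3)) / 8"
    using 1[of y] 1[of "y + 1"] 1[of "y + 2"] y by (simp add: add.assoc field_simps)
  also have "\<dots> = gam s / 4 * (y powr (- 2 * s) + 3 * (y + 1) powr (- 2 * s)
      + 3 * (y + 2) powr (- 2 * s) + (y + 3) powr (- 2 * s))"
    unfolding riesz_deriv_3[OF s] by (simp add: field_simps)
  finally show ?thesis by (simp add: y_def algebra_simps)
qed

section \<open>Fourth differences as Fourier integrals\<close>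

text \<open>Passes from gauge integrals of nonnegative functions to the Lebesgue integral.\<close>

lemma has_bochner_integral_of_has_integral:
  fixes f :: "real \<Rightarrow> real"
  assumes "(f has_integral I) S" "\<And>x. x \<in> S \<Longrightarrow> 0 \<le> f x"
    and [measurable]: "f \<in> borel_measurable borel" "S \<in> sets borel"
  shows "has_bochner_integral lborel (\<lambda>x. indicator S x * f x) I"
proof (rule has_bochner_integral_nn_integral)
  show "0 \<le> I" using assms(1,2) by (rule has_integral_nonneg)
  show "(\<integral>\<^sup>+x. ennreal (indicator S x * f x) \<partial>lborel) = ennreal I"
    using assms(1,2) by (intro nn_integral_has_integral_lebesgue)
  show "AE x in lborel. 0 \<le> indicator S x * f x"
    using assms(2) by (auto simp: indicator_def)
qed simp

lemma has_bochner_integral_even: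
  fixes f :: "real \<Rightarrow> real"
  assumes "has_bochner_integral lborel (\<lambda>x. indicator {0<..} x * f x) I"
    and "\<And>x. f (- x) = f x" "f 0 = 0"
  shows "has_bochner_integral lborel f (2 * I)"
proof -
  have "has_bochner_integral lborel (\<lambda>x. indicator {0<..} (- x) * f (- x)) I"
    using lborel_has_bochner_integral_real_affine_iff[of "-1" "\<lambda>x. indicator {0<..} x * f x" I 0] assms(1)
    by simp
  from has_bochner_integral_add[OF assms(1) this]
  have "has_bochner_integral lborel (\<lambda>x. indicator {0<..} x * f x + indicator {0<..} (- x) * f (- x)) (2 * I)"
    by simp
  also have "(\<lambda>x. indicator {0<..} x * f x + indicator {0<..} (- x) * f (- x)) = f"
    using assms(2,3) by (auto simp: fun_eq_iff indicator_def not_less)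
  finally show ?thesis .
qed

lemma has_bochner_integral_powr_0_1:
  fixes a :: real
  assumes "a > -1"
  shows "has_bochner_integral lborel (\<lambda>x. indicator {-1..1} x * \<bar>x\<bar> powr a) (2 / (a + 1))"
proof -
  have "((\<lambda>x. x powr a) has_integral (1 / (a + 1))) {0..1}"
    using has_integral_powr_from_0[OF assms, of 1] by simp
  then have "has_bochner_integral lborel (\<lambda>x. indicator {0..1} x * x powr a) (1 / (a + 1))"
    by (rule has_bochner_integral_of_has_integral) auto
  also have "(\<lambda>x. indicator {0..1} x * x powr a) =
      (\<lambda>x::real. indicator {0<..} x * (indicator {-1..1} x * \<bar>x\<bar> powr a))"
    by (auto simp: fun_eq_iff indicator_def)
  finally have "has_bochner_integral lborel (\<lambda>x. indicator {-1..1} x * \<bar>x\<bar> powr a) (2 * (1 / (a + 1)))"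
    by (rule has_bochner_integral_even) (simp_all add: indicator_def, blast)
  then show ?thesis by simp
qed

lemma has_bochner_integral_powr_1_inf:
  fixes a :: real
  assumes "a < -1"
  shows "has_bochner_integral lborel (\<lambda>x. indicator (- {-1..1}) x * \<bar>x\<bar> powr a) (- 2 / (a + 1))"
proof -
  have "((\<lambda>x. x powr a) has_integral - (1 powr (a + 1)) / (a + 1)) {1..}"
    by (rule has_integral_powr_to_inf) (use assms in auto)
  then have "((\<lambda>x. x powr a) has_integral (- 1 / (a + 1))) {1..}"
    by simp
  then have "((\<lambda>x. x powr a) has_integral (- 1 / (a + 1))) {1<..}"
    by (rule has_integral_spike_set_eq[THEN iffD1, rotated 2])
       (rule negligible_subset[OF negligible_sing[of 1]], force)+
  then have "has_bochner_integral lborel (\<lambda>x. indicator {1<..} x * x powr a) (- 1 / (a + 1))"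
    by (rule has_bochner_integral_of_has_integral) auto
  also have "(\<lambda>x. indicator {1<..} x * x powr a) =
      (\<lambda>x::real. indicator {0<..} x * (indicator (- {-1..1}) x * \<bar>x\<bar> powr a))"
    by (auto simp: fun_eq_iff indicator_def)
  finally have "has_bochner_integral lborel (\<lambda>x. indicator (- {-1..1}) x * \<bar>x\<bar> powr a) (2 * (- 1 / (a + 1)))"
    by (rule has_bochner_integral_even) (simp_all add: indicator_def, blast)
  then show ?thesis by simp
qed

lemma has_bochner_integral_powr_1_y:
  fixes a y :: real
  assumes "y \<ge> 1"
  shows "has_bochner_integral lborel (\<lambda>x. indicator ({-y..y} - {-1..1}) x * \<bar>x\<bar> powr a)
           (if a = -1 then 2 * ln y else 2 * (y powr (a + 1) - 1) / (a + 1))"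
proof -
  define F where "F x = (if a = -1 then ln x else x powr (a + 1) / (a + 1))" for x :: real
  have F: "(F has_real_derivative x powr a) (at x)" if "x > 0" for x
    using that unfolding F_def[abs_def]
    by (cases "a = -1") (auto intro!: derivative_eq_intros simp: powr_minus divide_inverse)
  have "((\<lambda>x. x powr a) has_integral F y - F 1) {1..y}"
  proof (rule fundamental_theorem_of_calculus[OF assms])
    fix x assume "x \<in> {1..y}"
    then have "(F has_vector_derivative x powr a) (at x)"
      using F[of x] by (simp add: has_real_derivative_iff_has_vector_derivative)
    then show "(F has_vector_derivative x powr a) (at x within {1..y})"
      by (rule has_vector_derivative_at_within)
  qed
  then have "((\<lambda>x. x powr a) has_integral F y - F 1) {1<..y}"
    by (rule has_integral_spike_set_eq[THEN iffD1, rotated 2])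
       (rule negligible_subset[OF negligible_sing[of 1]], force)+
  then have "has_bochner_integral lborel (\<lambda>x. indicator {1<..y} x * x powr a) (F y - F 1)"
    by (rule has_bochner_integral_of_has_integral) auto
  also have "(\<lambda>x. indicator {1<..y} x * x powr a) =
      (\<lambda>x::real. indicator {0<..} x * (indicator ({-y..y} - {-1..1}) x * \<bar>x\<bar> powr a))"
    using assms by (auto simp: fun_eq_iff indicator_def)
  finally have "has_bochner_integral lborel (\<lambda>x. indicator ({-y..y} - {-1..1}) x * \<bar>x\<bar> powr a) (2 * (F y - F 1))"
    by (rule has_bochner_integral_even) (simp_all add: indicator_def, blast)
  then show ?thesis by (simp add: F_def diff_divide_distrib split: if_splits)
qed

text \<open>With \<open>v = u / 2\<close> the remainder factors as \<open>2 (v - sin v) (v + sin v)\<close>.\<close>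

lemma cos_taylor_2: "\<bar>cos u - 1 + u\<^sup>2 / 2\<bar> \<le> u ^ 4 / 24" for u :: real
proof -
  define v where "v = u / 2"
  have sb: "\<bar>sin v - v\<bar> \<le> \<bar>v\<bar> ^ 3 / 6"
    using Maclaurin_sin_bound[of v 3] by (simp add: eval_nat_numeral sin_coeff_def divide_simps)
  have "cos u - 1 + u\<^sup>2 / 2 = 2 * (v - sin v) * (v + sin v)"
    using cos_double_sin[of v] by (simp add: v_def power2_eq_square algebra_simps)
  then have "\<bar>cos u - 1 + u\<^sup>2 / 2\<bar> = 2 * \<bar>sin v - v\<bar> * \<bar>v + sin v\<bar>"
    by (simp only: abs_mult abs_minus_commute[of v "sin v"] abs_numeral)
  also have "\<bar>v + sin v\<bar> \<le> 2 * \<bar>v\<bar>"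
    using abs_sin_x_le_abs_x[of v] abs_triangle_ineq[of v "sin v"] by linarith
  then have "2 * \<bar>sin v - v\<bar> * \<bar>v + sin v\<bar> \<le> 2 * (\<bar>v\<bar> ^ 3 / 6) * (2 * \<bar>v\<bar>)"
    using sb by (intro mult_mono) auto
  also have "\<dots> = u ^ 4 / 24"
  proof -
    have "\<bar>v\<bar> ^ 3 * \<bar>v\<bar> = v ^ 4" by (simp flip: power_Suc2)
    then show ?thesis by (simp add: v_def power_divide)
  qed
  finally show ?thesis .
qed

lemma cos_lower: "cos u - 1 + u\<^sup>2 / 2 \<ge> 0" for u :: real
proof -
  have "(sin (u / 2))\<^sup>2 \<le> (u / 2)\<^sup>2"
    by (metis abs_sin_x_le_abs_x abs_ge_zero power2_abs power_mono)
  then show ?thesis using cos_double_sin[of "u / 2"] by (simp add: power_divide)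
qed

text \<open>The cosine with its second order Taylor polynomial removed near \<open>0\<close>, and only its value at \<open>0\<close>
removed elsewhere. This is integrable against \<open>\<bar>x\<bar> powr (2 s - 4)\<close> for every \<open>s\<close> strictly between \<open>0\<close> and \<open>3/2\<close>, so
the cases \<open>s < 1/2\<close>, \<open>s = 1/2\<close> and \<open>s > 1/2\<close> can be treated together.\<close>

definition reg_kernel :: "real \<Rightarrow> real \<Rightarrow> real \<Rightarrow> real" where
  "reg_kernel s y x = \<bar>x\<bar> powr (2 * s - 4) * (cos (y * x) - 1 + indicator {-1..1} x * (y * x)\<^sup>2 / 2)"

lemma abs_powr_mult_power:
  fixes x :: real shows "\<bar>x\<bar> powr a * x ^ (2 * n) = (if x = 0 then 0 else \<bar>x\<bar> powr (a + 2 * n))"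
proof (cases "x = 0")
  case False
  then have "x ^ (2 * n) = \<bar>x\<bar> powr real (2 * n)"
    by (subst powr_realpow) (auto simp: power_even_abs)
  with False show ?thesis by (simp add: powr_add)
qed simp

lemma integrable_reg_kernel:
  assumes "0 < s" "s < 3/2" shows "integrable lborel (reg_kernel s y)"
proof -
  \<comment> \<open>The Taylor bound near 0 and the trivial bound elsewhere.\<close>
  let ?d = "\<lambda>x::real. y ^ 4 / 24 * (indicator {-1..1} x * \<bar>x\<bar> powr (2 * s)) +
      2 * (indicator (- {-1..1}) x * \<bar>x\<bar> powr (2 * s - 4))"
  have "integrable lborel ?d"
    using has_bochner_integral_powr_0_1[of "2 * s"] has_bochner_integral_powr_1_inf[of "2 * s - 4"] assms
    by (intro Bochner_Integration.integrable_add integrable_mult_right) (auto simp: has_bochner_integral_iff)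
  then show ?thesis
  proof (rule Bochner_Integration.integrable_bound)
    show "reg_kernel s y \<in> borel_measurable lborel" unfolding reg_kernel_def[abs_def] by measurable
    have "norm (reg_kernel s y x) \<le> norm (?d x)" for x
    proof (cases "x \<in> {-1..1}")
      case True
      have "norm (reg_kernel s y x) \<le> \<bar>x\<bar> powr (2 * s - 4) * ((y * x) ^ 4 / 24)"
        using mult_left_mono[OF cos_taylor_2[of "y * x"], of "\<bar>x\<bar> powr (2 * s - 4)"] True
        by (simp add: reg_kernel_def abs_mult)
      also have "\<dots> = y ^ 4 / 24 * (\<bar>x\<bar> powr (2 * s - 4) * x ^ (2 * 2))"
        by (simp add: power_mult_distrib mult_ac)
      also have "\<dots> \<le> ?d x" unfolding abs_powr_mult_power using True by simp
      finally show ?thesis by simp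
    next
      case False
      have "\<bar>cos (y * x) - 1\<bar> \<le> 2" using cos_le_one[of "y * x"] cos_ge_minus_one[of "y * x"] by linarith
      then have "norm (reg_kernel s y x) \<le> \<bar>x\<bar> powr (2 * s - 4) * 2"
        using False by (simp add: reg_kernel_def abs_mult mult_left_mono)
      also have "\<dots> = ?d x" using False by simp
      finally show ?thesis by simp
    qed
    then show "AE x in lborel. norm (reg_kernel s y x) \<le> norm (?d x)" by simp
  qed
qed

lemma reg_kernel_0 [simp]: "reg_kernel s 0 = (\<lambda>x. 0)" and reg_kernel_minus: "reg_kernel s (- y) = reg_kernel s y"
  by (simp_all add: reg_kernel_def fun_eq_iff)

definition riesz_integral :: "real \<Rightarrow> real \<Rightarrow> real" where
  "riesz_integral s y = (LINT x|lborel. reg_kernel s y x)"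

text \<open>Substituting \<open>x / y\<close> for \<open>x\<close> produces the factor \<open>y powr (3 - 2 s)\<close>; it also moves the cut-off from \<open>1\<close> to
\<open>y\<close>, and the quadratic term on the shell \<open>1 < \<bar>x\<bar> \<le> y\<close> contributes an elementary integral, which is
the logarithm if \<open>s = 1/2\<close>.\<close>

lemma riesz_integral_scaling:
  assumes s: "0 < s" "s < 3/2" and y: "y \<ge> 1"
  shows "riesz_integral s y = y powr (3 - 2 * s) *
    (riesz_integral s 1 + (if s = 1/2 then ln y else (y powr (2 * s - 1) - 1) / (2 * s - 1)))"
proof -
  let ?e = "\<lambda>x. indicator ({-y..y} - {-1..1}) x * \<bar>x\<bar> powr (2 * s - 2)"
  let ?I = "if 2 * s - 2 = -1 then 2 * ln y else 2 * (y powr (2 * s - 2 + 1) - 1) / (2 * s - 2 + 1)"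
  have e: "has_bochner_integral lborel ?e ?I"
    by (rule has_bochner_integral_powr_1_y[OF y])
  have pt: "reg_kernel s y (x / y) = y powr (4 - 2 * s) * (reg_kernel s 1 x + ?e x / 2)" for x
  proof -
    have 1: "\<bar>x / y\<bar> powr (2 * s - 4) = y powr (4 - 2 * s) * \<bar>x\<bar> powr (2 * s - 4)"
      using y powr_minus[of y "2 * s - 4"] by (simp add: powr_divide field_simps)
    have ind: "indicator {-1..1} (x / y) = (indicator {-1..1} x + indicator ({-y..y} - {-1..1}) x :: real)"
      using y by (auto simp: indicator_def field_simps)
    have 2: "\<bar>x\<bar> powr (2 * s - 4) * x\<^sup>2 = \<bar>x\<bar> powr (2 * s - 2)"
      using abs_powr_mult_power[of x "2 * s - 4" 1] by (simp add: power2_eq_square split: if_splits)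
    have "reg_kernel s y (x / y) = y powr (4 - 2 * s) * (\<bar>x\<bar> powr (2 * s - 4) *
        (cos x - 1 + indicator {-1..1} (x / y) * x\<^sup>2 / 2))"
      using y 1 by (simp add: reg_kernel_def)
    also have "\<dots> = y powr (4 - 2 * s) * (reg_kernel s 1 x + indicator ({-y..y} - {-1..1}) x *
        (\<bar>x\<bar> powr (2 * s - 4) * x\<^sup>2) / 2)"
      unfolding ind by (simp add: reg_kernel_def algebra_simps add_divide_distrib)
    finally show ?thesis unfolding 2 by simp
  qed
  have "riesz_integral s y = \<bar>1 / y\<bar> *\<^sub>R (LINT x|lborel. reg_kernel s y (0 + 1 / y * x))"
    unfolding riesz_integral_def by (rule lborel_integral_real_affine) (use y in auto)
  also have "\<dots> = 1 / y * (LINT x|lborel. y powr (4 - 2 * s) * (reg_kernel s 1 x + ?e x / 2))"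
    using y by (simp add: pt)
  also have "(LINT x|lborel. y powr (4 - 2 * s) * (reg_kernel s 1 x + ?e x / 2)) = y powr (4 - 2 * s) * (riesz_integral s 1 + ?I / 2)"
    unfolding riesz_integral_def using integrable_reg_kernel[OF s, of 1] e
    by (subst integral_mult_right_zero, subst Bochner_Integration.integral_add) (auto simp: has_bochner_integral_iff)
  also have "1 / y * (y powr (4 - 2 * s) * (riesz_integral s 1 + ?I / 2)) = y powr (3 - 2 * s) * (riesz_integral s 1 + ?I / 2)"
  proof -
    have "y powr (4 - 2 * s) = y * y powr (3 - 2 * s)"
      using y powr_add[of y 1 "3 - 2 * s"] by simp
    then show ?thesis using y by (simp only:) simp
  qed
  also have "?I / 2 = (if s = 1/2 then ln y else (y powr (2 * s - 1) - 1) / (2 * s - 1))"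
    by simp
  finally show ?thesis .
qed

text \<open>The integrand of the entry at distance \<open>p\<close> from the diagonal for mesh size \<open>1\<close>, up to the factor \<open>1 / (2 pi)\<close>.\<close>

definition entry_kernel :: "real \<Rightarrow> real \<Rightarrow> real \<Rightarrow> real" where
  "entry_kernel s p x = \<bar>x\<bar> powr (2 * s - 4) * (4 * (1 - cos x)\<^sup>2 * cos (p * x))"

text \<open>The trigonometric factor is a fourth difference of \<open>cos (y x)\<close> in \<open>y\<close>. The removed Taylor polynomial
is quadratic in \<open>y\<close>, hence annihilated.\<close>

lemma entry_kernel_eq:
  "entry_kernel s p x = reg_kernel s (p + 2) x - 4 * reg_kernel s (p + 1) x + 6 * reg_kernel s p x - 4 * reg_kernel s (p - 1) x + reg_kernel s (p - 2) x"
proof -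
  have 1: "cos ((p + 1) * x) + cos ((p - 1) * x) = 2 * cos (p * x) * cos x"
    by (simp add: distrib_right left_diff_distrib cos_add cos_diff)
  have 2: "cos ((p + 2) * x) + cos ((p - 2) * x) = 2 * cos (p * x) * (2 * (cos x)\<^sup>2 - 1)"
    using cos_double_cos[of x] by (simp add: distrib_right left_diff_distrib cos_add cos_diff)
  have "4 * (1 - cos x)\<^sup>2 * cos (p * x) =
    cos ((p + 2) * x) + cos ((p - 2) * x) - 4 * (cos ((p + 1) * x) + cos ((p - 1) * x)) + 6 * cos (p * x)"
    unfolding 1 2 by (simp add: power2_eq_square algebra_simps)
  moreover have "((p + 2) * x)\<^sup>2 - 4 * ((p + 1) * x)\<^sup>2 + 6 * (p * x)\<^sup>2 - 4 * ((p - 1) * x)\<^sup>2 + ((p - 2) * x)\<^sup>2 = 0"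
    by (simp add: power2_eq_square algebra_simps)
  moreover have "w * (c2 - 1 + i * q2 / 2) - 4 * (w * (c1 - 1 + i * q1 / 2)) + 6 * (w * (c0 - 1 + i * q0 / 2))
      - 4 * (w * (d1 - 1 + i * r1 / 2)) + w * (d2 - 1 + i * r2 / 2)
    = w * (c2 + d2 - 4 * (c1 + d1) + 6 * c0) + w * i / 2 * (q2 - 4 * q1 + 6 * q0 - 4 * r1 + r2)"
    for w i c0 c1 c2 d1 d2 q0 q1 q2 r1 r2 :: real
    by (simp add: algebra_simps add_divide_distrib diff_divide_distrib)
  ultimately show ?thesis unfolding entry_kernel_def reg_kernel_def by simp
qed

lemma has_bochner_integral_entry_kernel:
  assumes "0 < s" "s < 3/2"
  shows "has_bochner_integral lborel (entry_kernel s p)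
    (riesz_integral s (p + 2) - 4 * riesz_integral s (p + 1) + 6 * riesz_integral s p - 4 * riesz_integral s (p - 1) + riesz_integral s (p - 2))"
proof -
  have "has_bochner_integral lborel (reg_kernel s y) (riesz_integral s y)" for y
    using integrable_reg_kernel[OF assms] by (simp add: riesz_integral_def has_bochner_integral_iff)
  then show ?thesis unfolding entry_kernel_eq[abs_def]
    by (intro has_bochner_integral_add has_bochner_integral_diff has_bochner_integral_mult_right)
qed

text \<open>The coefficient of \<open>\<bar>y\<bar> powr (3 - 2 s)\<close> in \<open>riesz_integral s y\<close>; meaningful for \<open>s \<noteq> 1/2\<close>.\<close>

definition kappa :: "real \<Rightarrow> real" where
  "kappa s = riesz_integral s 1 + 1 / (1 - 2 * s)"

text \<open>The scaling law, with the terms quadratic in \<open>n\<close> separated because fourth differences annihilate them.\<close>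

lemma riesz_integral_eq:
  assumes s: "0 < s" "s < 3/2" and "n \<in> \<int>"
  shows "riesz_integral s n = (if s = 1/2 then n\<^sup>2 * riesz_integral s 1 + n\<^sup>2 * ln \<bar>n\<bar>
     else kappa s * \<bar>n\<bar> powr (3 - 2 * s) + n\<^sup>2 / (2 * s - 1))"
proof (cases "n = 0")
  case True
  then show ?thesis by (simp add: riesz_integral_def)
next
  case False
  then have n: "\<bar>n\<bar> \<ge> 1" using \<open>n \<in> \<int>\<close> by (rule Ints_nonzero_abs_ge1[rotated])
  have "riesz_integral s n = riesz_integral s \<bar>n\<bar>" by (simp add: riesz_integral_def reg_kernel_minus abs_if)
  also have "\<dots> = \<bar>n\<bar> powr (3 - 2 * s) *
    (riesz_integral s 1 + (if s = 1/2 then ln \<bar>n\<bar> else (\<bar>n\<bar> powr (2 * s - 1) - 1) / (2 * s - 1)))"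
    by (rule riesz_integral_scaling[OF s n])
  also have "\<dots> = (if s = 1/2 then n\<^sup>2 * riesz_integral s 1 + n\<^sup>2 * ln \<bar>n\<bar>
     else kappa s * \<bar>n\<bar> powr (3 - 2 * s) + n\<^sup>2 / (2 * s - 1))"
  proof (cases "s = 1/2")
    case True
    then have "3 - 2 * s = 2" by simp
    with n True show ?thesis by (simp add: distrib_left)
  next
    case False
    have "\<bar>n\<bar> powr (3 - 2 * s) * \<bar>n\<bar> powr (2 * s - 1) = n\<^sup>2"
      using n by (simp add: powr_numeral flip: powr_add)
    moreover have "1 / (1 - 2 * s) = - (1 / (2 * s - 1))"
      by (metis minus_diff_eq minus_divide_right)
    ultimately show ?thesis using False
      by (simp add: kappa_def algebra_simps diff_divide_distrib)
  qed
  finally show ?thesis .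
qed

text \<open>At \<open>s = 1/2\<close> the first summand vanishes with the sign and the second one takes its place.\<close>

lemma integral_entry_kernel:
  assumes s: "0 < s" "s < 3/2"
  shows "(LINT x|lborel. entry_kernel s (real p) x) = sgn (1/2 - s) * kappa s * fourth_diff s p + (if s = 1/2 then fourth_diff s p else 0)"
proof -
  have q: "(real p + 2)\<^sup>2 - 4 * (real p + 1)\<^sup>2 + 6 * (real p)\<^sup>2 - 4 * (real p - 1)\<^sup>2 + (real p - 2)\<^sup>2 = 0"
    by (simp add: power2_eq_square algebra_simps)
  have I: "real p + 2 \<in> \<int>" "real p + 1 \<in> \<int>" "real p \<in> \<int>" "real p - 1 \<in> \<int>" "real p - 2 \<in> \<int>" by auto
  have "(LINT x|lborel. entry_kernel s (real p) x) =
      riesz_integral s (real p + 2) - 4 * riesz_integral s (real p + 1) + 6 * riesz_integral s (real p) - 4 * riesz_integral s (real p - 1) + riesz_integral s (real p - 2)"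
    using has_bochner_integral_entry_kernel[OF s, of p] by (simp add: has_bochner_integral_iff)
  also have "\<dots> = sgn (1/2 - s) * kappa s * fourth_diff s p + (if s = 1/2 then fourth_diff s p else 0)"
  proof (cases "s = 1/2")
    case True
    have "riesz_integral s n = n\<^sup>2 * riesz_integral s 1 + riesz s n" if "n \<in> \<int>" for n
      using riesz_integral_eq[OF s that] by (simp add: True riesz_def)
    note riesz_integral = I[THEN this]
    have "riesz_integral s (real p + 2) - 4 * riesz_integral s (real p + 1) + 6 * riesz_integral s (real p) - 4 * riesz_integral s (real p - 1) + riesz_integral s (real p - 2) =
      ((real p + 2)\<^sup>2 - 4 * (real p + 1)\<^sup>2 + 6 * (real p)\<^sup>2 - 4 * (real p - 1)\<^sup>2 + (real p - 2)\<^sup>2) * riesz_integral s 1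
      + fourth_diff s p"
      unfolding riesz_integral fourth_diff_def by (simp only: algebra_simps)
    then show ?thesis unfolding q by (simp add: True)
  next
    case False
    have "riesz_integral s n = sgn (1/2 - s) * kappa s * riesz s n + n\<^sup>2 / (2 * s - 1)" if "n \<in> \<int>" for n
      using riesz_integral_eq[OF s that] False by (simp add: riesz_def sgn_if)
    note riesz_integral = I[THEN this]
    have "riesz_integral s (real p + 2) - 4 * riesz_integral s (real p + 1) + 6 * riesz_integral s (real p) - 4 * riesz_integral s (real p - 1) + riesz_integral s (real p - 2) =
      sgn (1/2 - s) * kappa s * fourth_diff s p
      + ((real p + 2)\<^sup>2 - 4 * (real p + 1)\<^sup>2 + 6 * (real p)\<^sup>2 - 4 * (real p - 1)\<^sup>2 + (real p - 2)\<^sup>2) / (2 * s - 1)"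
      unfolding riesz_integral fourth_diff_def by (simp only: algebra_simps add_divide_distrib diff_divide_distrib)
    then show ?thesis using False unfolding q by simp
  qed
  finally show ?thesis .
qed

section \<open>The constant kappa\<close>

lemma integral_entry_kernel_0_pos:
  assumes s: "0 < s" "s < 3/2" shows "(LINT x|lborel. entry_kernel s 0 x) > 0"
proof -
  have int: "integrable lborel (entry_kernel s 0)"
    using has_bochner_integral_entry_kernel[OF s, of 0] by (simp add: has_bochner_integral_iff)
  have nn: "entry_kernel s 0 x \<ge> 0" for x by (simp add: entry_kernel_def)
  have "(LINT x|lborel. entry_kernel s 0 x) \<noteq> 0"
  proof
    assume "(LINT x|lborel. entry_kernel s 0 x) = 0"
    then have "AE x in lborel. entry_kernel s 0 x = 0"
      using integral_nonneg_eq_0_iff_AE[OF int] nn by auto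
    moreover have "entry_kernel s 0 x \<noteq> 0" if "0 < x" "x < 1" for x :: real
    proof -
      have "cos x < cos 0" using that pi_gt3 by (intro cos_monotone_0_pi) auto
      then show ?thesis using that by (simp add: entry_kernel_def)
    qed
    ultimately have "AE x in lborel. x \<notin> {0<..<1::real}" by (auto elim!: eventually_mono)
    then have "emeasure lborel {0<..<1::real} = 0"
      by (subst (asm) AE_iff_measurable[of "{0<..<1::real}"]) auto
    then show False by simp
  qed
  moreover have "(LINT x|lborel. entry_kernel s 0 x) \<ge> 0" using nn by (intro integral_nonneg_AE) auto
  ultimately show ?thesis by linarith
qed

text \<open>The diagonal integral and \<open>third_diff s 0\<close> are both positive, which forces the sign of the constant
between them.\<close>

lemma kappa_sign:
  assumes s: "0 < s" "s < 3/2" "s \<noteq> 1/2" shows "sgn (1/2 - s) * kappa s > 0"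
proof -
  have "sgn (1/2 - s) * kappa s * fourth_diff s 0 > 0"
    using integral_entry_kernel_0_pos[OF s(1,2)] integral_entry_kernel[OF s(1,2), of 0] s(3) by simp
  then show ?thesis using third_diff_0_pos[OF s(1,2)] by (simp add: fourth_diff_0 zero_less_mult_iff)
qed

text \<open>The transforms of \<open>cos\<close>, \<open>1\<close> and \<open>x\<^sup>2 / 2\<close> are \<open>t / (1 + t\<^sup>2)\<close>, \<open>1 / t\<close> and \<open>1 / t ^ 3\<close>. The antiderivative of the
combination is written down explicitly; nonnegativity of the integrand makes the limit at infinity sufficient.\<close>

lemma laplace_cos_remainder:
  fixes t :: real
  assumes "t > 0"
  shows "(\<integral>\<^sup>+x. ennreal (exp (- t * x) * (cos x - 1 + x\<^sup>2 / 2)) * indicator {0..} x \<partial>lborel)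
    = ennreal (1 / (t ^ 3 * (1 + t\<^sup>2)))"
proof -
  define b c where "b = 1 / t" and "c = 1 / (1 + t\<^sup>2)"
  have t2: "1 + t\<^sup>2 > 0" using zero_le_power2[of t] by linarith
  have b: "t * b = 1" and c: "c > 0" "(1 + t\<^sup>2) * c = 1"
    using assms t2 by (simp_all add: b_def c_def)
  define q where "q x = (sin x - t * cos x) * c + b - x\<^sup>2 / 2 * b - x * b\<^sup>2 - b ^ 3" for x
  define F where "F x = exp (- t * x) * q x" for x
  have "(F has_real_derivative exp (- t * x) * (cos x - 1 + x\<^sup>2 / 2)) (at x)" for x
  proof -
    let ?q' = "(cos x + t * sin x) * c - x * b - b\<^sup>2"
    have "(q has_real_derivative ?q') (at x)"
      unfolding q_def[abs_def] by (auto intro!: derivative_eq_intros simp: algebra_simps)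
    moreover have "((\<lambda>x. exp (- t * x)) has_real_derivative exp (- t * x) * - t) (at x)"
      by (auto intro!: derivative_eq_intros)
    ultimately have "(F has_real_derivative exp (- t * x) * - t * q x + ?q' * exp (- t * x)) (at x)"
      unfolding F_def[abs_def] by (intro DERIV_mult)
    also have "exp (- t * x) * - t * q x + ?q' * exp (- t * x) = exp (- t * x) * (?q' - t * q x)"
      by (simp add: algebra_simps)
    also have "?q' - t * q x = cos x * ((1 + t\<^sup>2) * c) - (t * b) + x\<^sup>2 / 2 * (t * b)
        + (x * b + b\<^sup>2) * (t * b) - x * b - b\<^sup>2"
      unfolding q_def by (simp add: algebra_simps power2_eq_square power3_eq_cube)
    also have "\<dots> = cos x - 1 + x\<^sup>2 / 2" unfolding b c by simp
    finally show ?thesis .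
  qed
  moreover have "(F \<longlongrightarrow> 0) at_top"
  proof -
    have "((\<lambda>x. exp (- t * x) * ((sin x - t * cos x) * c)) \<longlongrightarrow> 0) at_top"
    proof (rule Lim_null_comparison)
      have "\<bar>sin x - t * cos x\<bar> \<le> 1 + t" for x
      proof -
        have "\<bar>t * cos x\<bar> \<le> t" using assms by (simp add: abs_mult mult_left_le)
        then show ?thesis using abs_sin_le_one[of x] by linarith
      qed
      then have "norm (exp (- t * x) * ((sin x - t * cos x) * c)) \<le> exp (- t * x) * ((1 + t) * c)" for x
        using c(1) by (simp add: abs_mult mult_right_mono)
      then show "\<forall>\<^sub>F x in at_top. norm (exp (- t * x) * ((sin x - t * cos x) * c)) \<le> exp (- t * x) * ((1 + t) * c)"
        by (intro always_eventually allI)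
      show "((\<lambda>x. exp (- t * x) * ((1 + t) * c)) \<longlongrightarrow> 0) at_top"
        by (rule tendsto_mult_left_zero) (use assms in real_asymp)
    qed
    moreover have "((\<lambda>x. exp (- t * x) * (b - x\<^sup>2 / 2 * b - x * b\<^sup>2 - b ^ 3)) \<longlongrightarrow> 0) at_top"
      using assms by real_asymp
    ultimately have "((\<lambda>x. exp (- t * x) * ((sin x - t * cos x) * c) +
        exp (- t * x) * (b - x\<^sup>2 / 2 * b - x * b\<^sup>2 - b ^ 3)) \<longlongrightarrow> 0) at_top"
      by (rule tendsto_add_zero)
    moreover have "F = (\<lambda>x. exp (- t * x) * ((sin x - t * cos x) * c) +
        exp (- t * x) * (b - x\<^sup>2 / 2 * b - x * b\<^sup>2 - b ^ 3))"
      by (simp add: fun_eq_iff F_def q_def algebra_simps)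
    ultimately show ?thesis by simp
  qed
  ultimately have "(\<integral>\<^sup>+x. ennreal (exp (- t * x) * (cos x - 1 + x\<^sup>2 / 2)) * indicator {0..} x \<partial>lborel) = 0 - F 0"
    using cos_lower by (intro nn_integral_FTC_atLeast) auto
  also have "0 - F 0 = 1 / (t ^ 3 * (1 + t\<^sup>2))"
  proof -
    \<comment> \<open>Partial fractions: \<open>1 = (1 + t\<^sup>2) c\<close> is inserted into \<open>b ^ 3\<close> and \<open>b\<close>.\<close>
    have "b ^ 3 * ((1 + t\<^sup>2) * c) = b ^ 3 * c + (t * b) * (t * b) * b * c"
      "b * ((1 + t\<^sup>2) * c) = b * c + (t * b) * t * c"
      by (simp_all add: algebra_simps power2_eq_square power3_eq_cube)
    then have "b ^ 3 = b ^ 3 * c + b * c" "b = b * c + t * c" unfolding b c by simp_all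
    then have "0 - F 0 = b ^ 3 * c" unfolding F_def q_def by simp
    also have "\<dots> = 1 / (t ^ 3 * (1 + t\<^sup>2))" by (simp add: b_def c_def power_divide)
    finally show ?thesis .
  qed
  finally show ?thesis by simp
qed

lemma Gamma_scaled:
  assumes "z > 0" "x > 0"
  shows "(\<integral>\<^sup>+t. ennreal (indicator {0..} t * t powr (z - 1) * exp (- t * x)) \<partial>lborel) = ennreal (Gamma z * x powr (- z))"
proof -
  have "ennreal (Gamma z) = (\<integral>\<^sup>+t. ennreal (indicator {0..} t * t powr (z - 1) / exp t) \<partial>lborel)"
    by (rule Gamma_conv_nn_integral_real[OF assms(1)])
  also have "\<dots> = ennreal \<bar>x\<bar> * (\<integral>\<^sup>+t. ennreal (indicator {0..} (0 + x * t) * (0 + x * t) powr (z - 1) / exp (0 + x * t)) \<partial>lborel)"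
    by (rule nn_integral_real_affine) (use assms in auto)
  also have "\<dots> = ennreal x * (\<integral>\<^sup>+t. ennreal (x powr (z - 1)) * ennreal (indicator {0..} t * t powr (z - 1) * exp (- t * x)) \<partial>lborel)"
    using assms by (auto simp: indicator_def powr_mult exp_minus divide_inverse mult_ac zero_le_mult_iff
        simp flip: ennreal_mult' intro!: arg_cong2[of _ _ _ _ "(*)"] nn_integral_cong)
  also have "\<dots> = ennreal (x powr z) * (\<integral>\<^sup>+t. ennreal (indicator {0..} t * t powr (z - 1) * exp (- t * x)) \<partial>lborel)"
    using assms powr_add[of x 1 "z - 1"]
    by (subst nn_integral_cmult) (auto simp: ennreal_mult' mult.assoc)
  finally have "ennreal (x powr (- z)) * ennreal (Gamma z) =
      ennreal (x powr (- z)) * ennreal (x powr z) * (\<integral>\<^sup>+t. ennreal (indicator {0..} t * t powr (z - 1) * exp (- t * x)) \<partial>lborel)"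
    by (simp add: mult.assoc)
  moreover have "ennreal (x powr (- z)) * ennreal (x powr z) = 1"
    using assms by (simp flip: ennreal_mult' powr_add)
  ultimately show ?thesis by (simp add: mult.commute ennreal_mult'')
qed

text \<open>The substitution \<open>y = t\<^sup>2 / (1 + t\<^sup>2)\<close> turns the integral into half the Beta integral with parameters
\<open>1/2 - s\<close> and \<open>1/2 + s\<close>, which the reflection formula evaluates.\<close>

lemma integral_powr_over_1_plus_square:
  assumes s: "0 < s" "s < 1/2"
  shows "(\<integral>\<^sup>+t. ennreal (indicator {0<..} t * (t powr (- 2 * s) / (1 + t\<^sup>2))) \<partial>lborel) = ennreal (pi / (2 * cos (s * pi)))"
proof -
  define u v where "u = 1/2 - s" and "v = 1/2 + s"
  have uv: "u > 0" "v > 0" "u + v = 1" using s by (auto simp: u_def v_def)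
  let ?f = "\<lambda>y. y powr (u - 1) * (1 - y) powr (v - 1)"
  let ?g = "\<lambda>t::real. t\<^sup>2 / (1 + t\<^sup>2)" and ?g' = "\<lambda>t::real. 2 * t / (1 + t\<^sup>2)\<^sup>2"
  have pos: "1 + t\<^sup>2 > 0" for t :: real using zero_le_power2[of t] by linarith
  have der: "(?g has_field_derivative ?g' t) (at t within {0<..})" for t
    using pos[of t] by (auto intro!: derivative_eq_intros simp: field_simps power2_eq_square)
  have inj: "inj_on ?g {0<..}"
  proof (rule inj_onI)
    fix x y :: real assume "x \<in> {0<..}" "y \<in> {0<..}" "?g x = ?g y"
    then have "x\<^sup>2 = y\<^sup>2" using pos[of x] pos[of y] by (simp add: field_simps)
    with \<open>x \<in> _\<close> \<open>y \<in> _\<close> show "x = y" by simp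
  qed
  have img: "?g ` {0<..} = {0<..<1}"
  proof (intro equalityI subsetI)
    fix y :: real assume y: "y \<in> {0<..<1}"
    then have "y = ?g (sqrt (y / (1 - y)))" "sqrt (y / (1 - y)) > 0" by (auto simp: field_simps)
    then show "y \<in> ?g ` {0<..}" by blast
  qed (use pos in \<open>auto simp: field_simps\<close>)
  have "(?f has_integral Beta u v) {0<..<1}"
    using has_integral_Beta_real[OF uv(1,2)] by (simp add: has_integral_Icc_iff_Ioo)
  then have "?f absolutely_integrable_on {0<..<1}" "integral {0<..<1} ?f = Beta u v"
    by (auto intro!: nonnegative_absolutely_integrable_1 simp: has_integral_iff)
  then have "(\<lambda>t. \<bar>?g' t\<bar> * ?f (?g t)) absolutely_integrable_on {0<..} \<and>
      integral {0<..} (\<lambda>t. \<bar>?g' t\<bar> * ?f (?g t)) = Beta u v"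
    using has_absolute_integral_change_of_variables_1'[of "{0<..}" ?g ?g' ?f "Beta u v", OF _ der inj]
    by (simp add: img)
  then have hi: "((\<lambda>t. \<bar>?g' t\<bar> * ?f (?g t)) has_integral Beta u v) {0<..}"
    by (auto simp: has_integral_iff dest: set_lebesgue_integral_eq_integral(1))
  have subst: "\<bar>?g' t\<bar> * ?f (?g t) = 2 * (t powr (- 2 * s) / (1 + t\<^sup>2))" if "t > 0" for t
  proof -
    have "1 - ?g t = 1 / (1 + t\<^sup>2)" using pos[of t] by (simp add: field_simps)
    moreover have inv: "1 / (1 + t\<^sup>2) powr (e - 1) = (1 + t\<^sup>2) powr (1 - e)" for e
      using powr_minus_divide[of "1 + t\<^sup>2" "e - 1"] by simp
    moreover have "(1 / (1 + t\<^sup>2)) powr (v - 1) = 1 / (1 + t\<^sup>2) powr (v - 1)"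
      "(?g t) powr (u - 1) = (t\<^sup>2) powr (u - 1) * (1 / (1 + t\<^sup>2) powr (u - 1))"
      using pos[of t] by (simp_all add: powr_divide)
    ultimately have "?f (?g t) = (t\<^sup>2) powr (u - 1) * ((1 + t\<^sup>2) powr (1 - u) * (1 + t\<^sup>2) powr (1 - v))"
      by (simp only: inv mult.assoc)
    also have "(1 + t\<^sup>2) powr (1 - u) * (1 + t\<^sup>2) powr (1 - v) = 1 + t\<^sup>2"
    proof -
      have e: "1 - u + (1 - v) = 1" using uv by simp
      show ?thesis unfolding powr_add[symmetric] e using pos[of t] by simp
    qed
    also have "(t\<^sup>2) powr (u - 1) = t powr (- 2 * s - 1)"
    proof -
      have "t\<^sup>2 = t powr 2" using that by simp
      moreover have "2 * (u - 1) = - 2 * s - 1" by (simp add: u_def)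
      ultimately show ?thesis by (simp only: powr_powr)
    qed
    also have "t powr (- 2 * s - 1) = t powr (- 2 * s) / t"
      using that by (simp add: powr_diff)
    finally have fg: "?f (?g t) = t powr (- 2 * s) / t * (1 + t\<^sup>2)" .
    have cancel: "\<bar>2 * t / X\<^sup>2\<bar> * (y / t * X) = 2 * (y / X)" if "X > 0" for X y
      using that \<open>t > 0\<close> by (simp add: power2_eq_square)
    show ?thesis unfolding fg by (rule cancel[OF pos])
  qed
  have "((\<lambda>t. 2 * (t powr (- 2 * s) / (1 + t\<^sup>2))) has_integral Beta u v) {0<..}"
  proof (rule has_integral_eq[OF _ hi])
    fix t :: real assume "t \<in> {0<..}"
    then show "\<bar>?g' t\<bar> * ?f (?g t) = 2 * (t powr (- 2 * s) / (1 + t\<^sup>2))" by (intro subst) simp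
  qed
  then have "((\<lambda>t. t powr (- 2 * s) / (1 + t\<^sup>2)) has_integral Beta u v / 2) {0<..}"
    using has_integral_mult_right[of "\<lambda>t. 2 * (t powr (- 2 * s) / (1 + t\<^sup>2))" _ _ "1/2"] by fastforce
  then have "(\<integral>\<^sup>+t. ennreal (indicator {0<..} t * (t powr (- 2 * s) / (1 + t\<^sup>2))) \<partial>lborel) = ennreal (Beta u v / 2)"
    by (intro nn_integral_has_integral_lebesgue) auto
  also have "Beta u v = pi / cos (s * pi)"
  proof -
    have v: "v = 1 - u" using uv by simp
    have "Gamma (complex_of_real u) * Gamma (complex_of_real v) = of_real pi / sin (of_real pi * of_real u)"
      using Gamma_reflection_complex[of "of_real u"] unfolding v by simp
    then have "complex_of_real (Gamma u * Gamma v) = of_real (pi / sin (pi * u))"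
      by (simp add: Gamma_complex_of_real sin_of_real flip: of_real_mult of_real_divide)
    then have "Gamma u * Gamma v = pi / sin (pi * u)" by (simp only: of_real_eq_iff)
    also have "sin (pi * u) = cos (s * pi)" by (simp add: u_def cos_sin_eq algebra_simps)
    finally show ?thesis using uv by (simp add: Beta_def)
  qed
  finally show ?thesis by (simp add: mult.commute)
qed

text \<open>For \<open>s < 1/2\<close> the cut-off can be dropped, and \<open>kappa s\<close> is the integral of
\<open>\<bar>x\<bar> powr (2 s - 4) * (cos x - 1 + x\<^sup>2 / 2)\<close>. Writing the power as a Gamma integral and exchanging
the integrations of nonnegative functions leaves the Laplace transform of the remainder of the cosine.\<close>

lemma kappa_eq:
  assumes s: "0 < s" "s < 1/2"
  shows "kappa s = 2 * pi * A_coeff s"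
proof -
  define z where "z = 4 - 2 * s"
  have z: "z > 0" using s by (simp add: z_def)
  let ?r = "\<lambda>x. \<bar>x\<bar> powr (- z) * (cos x - 1 + x\<^sup>2 / 2)"
  have "has_bochner_integral lborel (\<lambda>x. indicator (- {-1..1}) x * \<bar>x\<bar> powr (2 * s - 2)) (- 2 / (2 * s - 2 + 1))"
    by (rule has_bochner_integral_powr_1_inf) (use s in auto)
  from has_bochner_integral_add[OF _ has_bochner_integral_divide_zero[OF this, of 2], of "reg_kernel s 1" "riesz_integral s 1"]
  have "has_bochner_integral lborel (\<lambda>x. reg_kernel s 1 x + indicator (- {-1..1}) x * \<bar>x\<bar> powr (2 * s - 2) / 2) (kappa s)"
    using integrable_reg_kernel[of s 1] s by (simp add: kappa_def has_bochner_integral_iff riesz_integral_def)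
       (simp add: field_simps)
  also have "(\<lambda>x. reg_kernel s 1 x + indicator (- {-1..1}) x * \<bar>x\<bar> powr (2 * s - 2) / 2) = ?r"
  proof
    fix x :: real
    have "\<bar>x\<bar> powr (2 * s - 4) * x\<^sup>2 = \<bar>x\<bar> powr (2 * s - 2)"
      using abs_powr_mult_power[of x "2 * s - 4" 1] by (simp add: power2_eq_square split: if_splits)
    then show "reg_kernel s 1 x + indicator (- {-1..1}) x * \<bar>x\<bar> powr (2 * s - 2) / 2 = ?r x"
      by (cases "x \<in> {-1..1}") (simp_all add: reg_kernel_def z_def algebra_simps)
  qed
  finally have r: "has_bochner_integral lborel ?r (kappa s)" .
  have "kappa s > 0" using kappa_sign[of s] s by simp
  have "ennreal (kappa s) = (\<integral>\<^sup>+x. ennreal (?r x) \<partial>lborel)"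
    using r cos_lower by (subst nn_integral_eq_integral) (auto simp: has_bochner_integral_iff)
  also have "\<dots> = (\<integral>\<^sup>+x. ennreal (indicator {0..} x * ?r x) + ennreal (indicator {0..} (- x) * ?r (- x)) \<partial>lborel)"
    by (intro nn_integral_cong) (auto simp: indicator_def)
  also have "\<dots> = (\<integral>\<^sup>+x. ennreal (indicator {0..} x * ?r x) \<partial>lborel) + (\<integral>\<^sup>+x. ennreal (indicator {0..} (- x) * ?r (- x)) \<partial>lborel)"
    by (intro nn_integral_add) auto
  also have "(\<integral>\<^sup>+x. ennreal (indicator {0..} (- x) * ?r (- x)) \<partial>lborel) = (\<integral>\<^sup>+x. ennreal (indicator {0..} x * ?r x) \<partial>lborel)"
    using nn_integral_real_affine[of "\<lambda>x. ennreal (indicator {0..} x * ?r x)" "-1" 0] by simp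
  finally have half: "ennreal (kappa s) = 2 * (\<integral>\<^sup>+x. ennreal (indicator {0..} x * ?r x) \<partial>lborel)"
    by (simp add: mult_2)
  have "ennreal (Gamma z) * (\<integral>\<^sup>+x. ennreal (indicator {0..} x * ?r x) \<partial>lborel) =
      (\<integral>\<^sup>+x. ennreal (indicator {0<..} x * (cos x - 1 + x\<^sup>2 / 2)) * ennreal (Gamma z * x powr (- z)) \<partial>lborel)"
    using Gamma_real_pos[OF z] cos_lower
    by (subst nn_integral_cmult[symmetric])
       (auto simp: indicator_def mult_ac simp flip: ennreal_mult' intro!: nn_integral_cong)
  also have "\<dots> = (\<integral>\<^sup>+x. ennreal (indicator {0<..} x * (cos x - 1 + x\<^sup>2 / 2)) *
      (\<integral>\<^sup>+t. ennreal (indicator {0..} t * t powr (z - 1) * exp (- t * x)) \<partial>lborel) \<partial>lborel)"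
    using Gamma_scaled[OF z] by (intro nn_integral_cong) (auto simp: indicator_def)
  also have "\<dots> = (\<integral>\<^sup>+x. (\<integral>\<^sup>+t. ennreal (indicator {0<..} x * (cos x - 1 + x\<^sup>2 / 2)) *
      ennreal (indicator {0..} t * t powr (z - 1) * exp (- t * x)) \<partial>lborel) \<partial>lborel)"
    by (intro nn_integral_cong nn_integral_cmult[symmetric]) auto
  also have "\<dots> = (\<integral>\<^sup>+t. (\<integral>\<^sup>+x. ennreal (indicator {0<..} x * (cos x - 1 + x\<^sup>2 / 2)) *
      ennreal (indicator {0..} t * t powr (z - 1) * exp (- t * x)) \<partial>lborel) \<partial>lborel)"
    by (rule lborel_pair.Fubini') simp
  also have "\<dots> = (\<integral>\<^sup>+t. ennreal (indicator {0<..} t * (t powr (- 2 * s) / (1 + t\<^sup>2))) \<partial>lborel)"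
  proof (rule nn_integral_cong)
    fix t :: real
    show "(\<integral>\<^sup>+x. ennreal (indicator {0<..} x * (cos x - 1 + x\<^sup>2 / 2)) *
      ennreal (indicator {0..} t * t powr (z - 1) * exp (- t * x)) \<partial>lborel) = ennreal (indicator {0<..} t * (t powr (- 2 * s) / (1 + t\<^sup>2)))"
    proof (cases "t > 0")
      case True
      have "(\<integral>\<^sup>+x. ennreal (indicator {0<..} x * (cos x - 1 + x\<^sup>2 / 2)) *
          ennreal (indicator {0..} t * t powr (z - 1) * exp (- t * x)) \<partial>lborel) =
        (\<integral>\<^sup>+x. ennreal (t powr (z - 1)) * (ennreal (exp (- t * x) * (cos x - 1 + x\<^sup>2 / 2)) * indicator {0..} x) \<partial>lborel)"
        using True cos_lower
        by (intro nn_integral_cong) (auto simp: indicator_def mult_ac simp flip: ennreal_mult')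
      also have "\<dots> = ennreal (t powr (z - 1)) * ennreal (1 / (t ^ 3 * (1 + t\<^sup>2)))"
        unfolding laplace_cos_remainder[OF True, symmetric] by (intro nn_integral_cmult) measurable
      also have "\<dots> = ennreal (t powr (z - 1) * (1 / (t ^ 3 * (1 + t\<^sup>2))))"
        by (rule ennreal_mult'[symmetric]) simp
      also have "t powr (z - 1) * (1 / (t ^ 3 * (1 + t\<^sup>2))) = t powr (- 2 * s) / (1 + t\<^sup>2)"
      proof -
        have "t powr (z - 1) = t powr (- 2 * s) * t ^ 3"
          using True powr_add[of t "- 2 * s" 3] by (simp add: z_def algebra_simps)
        then show ?thesis using True by simp
      qed
      finally show ?thesis using True by simp
    next
      case False
      then have 0: "indicator {0..} t * t powr (z - 1) * exp (- t * x) = 0" for x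
        by (cases "t = 0") auto
      show ?thesis unfolding 0 using False by simp
    qed
  qed
  also have "\<dots> = ennreal (pi / (2 * cos (s * pi)))" by (rule integral_powr_over_1_plus_square[OF s])
  finally have tonelli: "ennreal (Gamma z) * (\<integral>\<^sup>+x. ennreal (indicator {0..} x * ?r x) \<partial>lborel) =
      ennreal (pi / (2 * cos (s * pi)))" .
  have "ennreal (Gamma z) * ennreal (kappa s) = 2 * ennreal (pi / (2 * cos (s * pi)))"
    unfolding half tonelli[symmetric] by (rule mult.left_commute)
  moreover have "2 * ennreal (pi / (2 * cos (s * pi))) = ennreal (2 * (pi / (2 * cos (s * pi))))"
    by (subst ennreal_mult') simp_all
  ultimately have "ennreal (Gamma z * kappa s) = ennreal (2 * (pi / (2 * cos (s * pi))))"
    using \<open>kappa s > 0\<close> by (simp only: ennreal_mult'' less_imp_le)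
  moreover have c: "cos (s * pi) > 0"
  proof (rule cos_gt_zero_pi)
    have "0 < s * pi" using s by simp
    then show "- (pi / 2) < s * pi" using pi_gt_zero by linarith
    show "s * pi < pi / 2" using s by simp
  qed
  moreover have "0 \<le> Gamma z * kappa s" using \<open>kappa s > 0\<close> Gamma_real_pos[OF z] by simp
  moreover have "0 \<le> 2 * (pi / (2 * cos (s * pi)))" using c by simp
  ultimately have "Gamma z * kappa s = 2 * (pi / (2 * cos (s * pi)))"
    by (simp only: ennreal_inj)
  then have "Gamma z * kappa s = pi / cos (s * pi)" by simp
  moreover have "Gamma z \<noteq> 0" using Gamma_real_pos[OF z] by simp
  ultimately have "kappa s = pi / cos (s * pi) / Gamma z" by (metis nonzero_mult_div_cancel_left)
  then show ?thesis unfolding A_coeff_def z_def[symmetric] by simp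
qed

section \<open>Fourier transform of the hat functions\<close>

lemma fourier_minus: "fourier u (- \<xi>) = cnj (fourier u \<xi>)"
proof -
  have "cnj (LINT x|lborel. of_real (u x) * exp (- (\<i> * of_real (\<xi> * x)))) =
      (LINT x|lborel. cnj (of_real (u x) * exp (- (\<i> * of_real (\<xi> * x)))))"
    by (rule Bochner_Integration.integral_cnj[symmetric])
  then show ?thesis by (simp add: fourier_def exp_cnj)
qed

text \<open>Transforms of real functions satisfy \<open>F(- \<xi>) = cnj (F \<xi>)\<close>, so reflection conjugates the integral.\<close>

lemma stiffness_integral_real: "stiffness_integral a b N s k j \<in> \<real>"
proof -
  let ?f = "\<lambda>\<xi>. complex_of_real (\<bar>\<xi>\<bar> powr (2 * s)) *
        fourier (hat a b N j) \<xi> * cnj (fourier (hat a b N k) \<xi>)"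
  have "integral\<^sup>L lborel ?f = (LINT \<xi>|lborel. ?f (0 + (- 1) * \<xi>))"
    using lborel_integral_real_affine[of "-1" ?f 0] by simp
  also have "\<dots> = (LINT \<xi>|lborel. cnj (?f \<xi>))" by (simp add: fourier_minus)
  also have "\<dots> = cnj (integral\<^sup>L lborel ?f)" by (rule Bochner_Integration.integral_cnj)
  finally show ?thesis unfolding stiffness_integral_def by (simp add: Reals_cnj_iff)
qed

text \<open>The building block of the transform of a piecewise linear function; \<open>F\<close> is the antiderivative obtained by
integrating by parts.\<close>

lemma has_bochner_integral_linear_times_cis:
  assumes "l \<le> r" "\<xi> \<noteq> 0"
  defines "F \<equiv> \<lambda>x. cis (- (\<xi> * x)) * (of_real (x - l) * (\<i> / of_real \<xi>) + 1 / (of_real \<xi>)\<^sup>2)"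
  shows "has_bochner_integral lborel
    (\<lambda>x. indicator {l..r} x *\<^sub>R (of_real (x - l) * cis (- (\<xi> * x)))) (F r - F l)"
proof (rule has_bochner_integral_FTC_Icc[OF assms(1)])
  fix x :: real
  define Fc where "Fc z = exp (- (\<i> * of_real \<xi> * z)) * ((z - of_real l) * (\<i> / of_real \<xi>) + 1 / (of_real \<xi>)\<^sup>2)" for z
  have E: "exp (- (\<i> * of_real \<xi> * of_real x)) = cis (- (\<xi> * x))" for x
    by (simp add: cis_conv_exp mult_ac)
  have "(Fc has_field_derivative of_real (x - l) * cis (- (\<xi> * x))) (at (of_real x))"
    unfolding Fc_def[abs_def] E[symmetric]
    by (rule derivative_eq_intros refl | simp)+
       (use assms(2) in \<open>simp add: field_simps power2_eq_square\<close>)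
  then have "((\<lambda>x. Fc (of_real x)) has_vector_derivative of_real (x - l) * cis (- (\<xi> * x))) (at x within {l..r})"
    by (rule has_vector_derivative_real_field)
  moreover have "(\<lambda>x. Fc (of_real x)) = F"
    by (simp add: fun_eq_iff Fc_def F_def E)
  ultimately show "(F has_vector_derivative of_real (x - l) * cis (- (\<xi> * x))) (at x within {l..r})" by simp
next
  show "continuous_on {l..r} (\<lambda>x. of_real (x - l) * cis (- (\<xi> * x)))"
    by (intro continuous_intros)
qed

lemma cis_plus_cis_minus: "cis t + cis (- t) = of_real (2 * cos t)"
  by (simp add: complex_eq_iff)

lemma fourier_hat:
  assumes "a < b" "N > 0" "j \<ge> 1" "\<xi> \<noteq> 0"
  defines "h \<equiv> mesh_size a b N" and "c \<equiv> mesh_node a b N j"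
  shows "fourier (hat a b N j) \<xi> = of_real (2 * (1 - cos (h * \<xi>)) / (h * \<xi>\<^sup>2 * sqrt (2 * pi))) * cis (- (\<xi> * c))"
proof -
  have h: "h > 0" using assms by (simp add: h_def mesh_size_def)
  have nodes: "mesh_node a b N (j - 1) = c - h" "mesh_node a b N (j + 1) = c + h"
    using assms(3) by (simp_all add: c_def h_def mesh_node_def algebra_simps of_nat_diff)
  let ?E = "\<lambda>x. cis (- (\<xi> * x))"
  let ?L = "\<lambda>l x. indicator {l..c + h} x *\<^sub>R (of_real (x - l) * ?E x)"
  let ?P = "\<lambda>l x. ?E x * (of_real (x - l) * (\<i> / of_real \<xi>) + 1 / (of_real \<xi>)\<^sup>2)"
  \<comment> \<open>The hat function is a ramp from \<open>c - h\<close> minus twice a ramp from \<open>c\<close>, both cut off at \<open>c + h\<close>. The second ramp vanishes at \<open>c\<close>, so this holds at the node as well.\<close>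
  have hat: "of_real (hat a b N j x) * ?E x = (?L (c - h) x - 2 *\<^sub>R ?L c x) /\<^sub>R h" for x
    unfolding hat_def nodes c_def[symmetric] h_def[symmetric]
    using h by (auto simp: indicator_def scaleR_conv_of_real field_simps)
  have "has_bochner_integral lborel (\<lambda>x. (?L (c - h) x - 2 *\<^sub>R ?L c x) /\<^sub>R h)
      (((?P (c - h) (c + h) - ?P (c - h) (c - h)) - 2 *\<^sub>R (?P c (c + h) - ?P c c)) /\<^sub>R h)"
    using h assms(4)
    by (intro has_bochner_integral_scaleR_right has_bochner_integral_diff
        has_bochner_integral_linear_times_cis) auto
  then have "(LINT x|lborel. of_real (hat a b N j x) * ?E x) =
      ((?P (c - h) (c + h) - ?P (c - h) (c - h)) - 2 *\<^sub>R (?P c (c + h) - ?P c c)) /\<^sub>R h"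
    by (simp only: hat has_bochner_integral_iff)
  also have "\<dots> = (2 * ?E c - (?E (c + h) + ?E (c - h))) / (of_real \<xi>)\<^sup>2 / of_real h"
    by (simp add: scaleR_conv_of_real divide_inverse algebra_simps)
  also have "?E (c + h) + ?E (c - h) = ?E c * (cis (h * \<xi>) + cis (- (h * \<xi>)))"
    by (simp add: cis_mult distrib_left algebra_simps)
  also have "(2 * ?E c - ?E c * (cis (h * \<xi>) + cis (- (h * \<xi>)))) / (of_real \<xi>)\<^sup>2 / of_real h
      = of_real (2 * (1 - cos (h * \<xi>)) / (h * \<xi>\<^sup>2)) * ?E c"
    unfolding cis_plus_cis_minus by (simp add: algebra_simps diff_divide_distrib)
  finally have "(LINT x|lborel. of_real (hat a b N j x) * exp (- (\<i> * of_real (\<xi> * x)))) =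
      of_real (2 * (1 - cos (h * \<xi>)) / (h * \<xi>\<^sup>2)) * ?E c"
    by (simp add: cis_conv_exp mult_ac)
  then show ?thesis unfolding fourier_def by simp
qed

lemma stiffness_integrand_eq:
  assumes "h > 0"
  shows "\<bar>\<xi>\<bar> powr (2 * s) * (2 * (1 - cos (h * \<xi>)) / (h * \<xi>\<^sup>2 * sqrt (2 * pi)))\<^sup>2 * cos (p * (h * \<xi>))
    = h powr (2 - 2 * s) / (2 * pi) * entry_kernel s p (h * \<xi>)"
proof (cases "\<xi> = 0")
  case False
  let ?u = "\<bar>\<xi>\<bar> powr (2 * s - 4)"
  have 1: "\<bar>h * \<xi>\<bar> powr (2 * s - 4) = h powr (2 * s - 4) * ?u"
    using assms by (simp add: abs_mult powr_mult)
  have 2: "\<bar>\<xi>\<bar> powr (2 * s) = ?u * \<xi> ^ 4"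
    using abs_powr_mult_power[of \<xi> "2 * s - 4" 2] False by simp
  have 3: "h powr (2 - 2 * s) * h powr (2 * s - 4) = 1 / h\<^sup>2"
    using assms by (simp add: powr_minus powr_numeral divide_inverse flip: powr_add)
  have 4: "(2 * (1 - cos (h * \<xi>)) / (h * \<xi>\<^sup>2 * sqrt (2 * pi)))\<^sup>2 =
      4 * (1 - cos (h * \<xi>))\<^sup>2 / (h\<^sup>2 * \<xi> ^ 4 * (2 * pi))"
    by (simp only: power_divide power_mult_distrib) simp
  have "\<bar>\<xi>\<bar> powr (2 * s) * (2 * (1 - cos (h * \<xi>)) / (h * \<xi>\<^sup>2 * sqrt (2 * pi)))\<^sup>2 * cos (p * (h * \<xi>)) =
      (1 / h\<^sup>2) / (2 * pi) * ?u * (4 * (1 - cos (h * \<xi>))\<^sup>2 * cos (p * (h * \<xi>)))"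
    unfolding 2 4 using False by simp
  also have "\<dots> = h powr (2 - 2 * s) / (2 * pi) * entry_kernel s p (h * \<xi>)"
    unfolding 3[symmetric] entry_kernel_def 1 by simp
  finally show ?thesis .
qed (simp add: entry_kernel_def)

text \<open>The phases of the two hat functions combine to \<open>cis (- (p h \<xi>))\<close> with \<open>p = j - k\<close>, whose real part is the
cosine in \<open>entry_kernel\<close>; rescaling \<open>\<xi>\<close> by \<open>h\<close> gives the power of \<open>h\<close>.\<close>

lemma stiffness_eq_entry_kernel:
  assumes "a < b" "N > 0" "k \<ge> 1" "j \<ge> 1" "0 < s" "s < 3/2"
  defines "h \<equiv> mesh_size a b N"
  shows "stiffness a b N s k j = h powr (1 - 2 * s) / (2 * pi) * (LINT x|lborel. entry_kernel s \<bar>real k - real j\<bar> x)"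
proof -
  have h: "h > 0" using assms by (simp add: h_def mesh_size_def)
  define p where "p = real j - real k"
  let ?f = "\<lambda>\<xi>. complex_of_real (\<bar>\<xi>\<bar> powr (2 * s)) *
        fourier (hat a b N j) \<xi> * cnj (fourier (hat a b N k) \<xi>)"
  define w where "w \<xi> = \<bar>\<xi>\<bar> powr (2 * s) * (2 * (1 - cos (h * \<xi>)) / (h * \<xi>\<^sup>2 * sqrt (2 * pi)))\<^sup>2" for \<xi>
  have f: "?f \<xi> = of_real (w \<xi>) * cis (- (p * (h * \<xi>)))" for \<xi>
  proof (cases "\<xi> = 0")
    case False
    have c: "cis (- (\<xi> * mesh_node a b N j)) * cnj (cis (- (\<xi> * mesh_node a b N k))) = cis (- (p * (h * \<xi>)))"
      by (simp add: cis_cnj cis_mult p_def mesh_node_def h_def algebra_simps)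
    have m: "of_real u * (of_real v * y) * cnj (of_real v * z) = of_real (u * v\<^sup>2) * (y * cnj z)"
      for u v :: real and y z :: complex
      by (simp add: power2_eq_square)
    show ?thesis
      unfolding fourier_hat[OF assms(1,2,4) False] fourier_hat[OF assms(1,2,3) False] h_def[symmetric] w_def
      by (simp only: m c)
  qed (simp add: w_def)
  have kern_h: "has_bochner_integral lborel (\<lambda>\<xi>. h powr (2 - 2 * s) / (2 * pi) * entry_kernel s p (h * \<xi>))
     (h powr (2 - 2 * s) / (2 * pi) * ((LINT x|lborel. entry_kernel s p x) / h))" for p
  proof -
    have "has_bochner_integral lborel (entry_kernel s p) (LINT x|lborel. entry_kernel s p x)"
      using has_bochner_integral_entry_kernel[OF assms(5,6), of p] by (simp add: has_bochner_integral_iff)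
    from iffD1[OF lborel_has_bochner_integral_real_affine_iff[of h "entry_kernel s p" _ 0] this]
    have "has_bochner_integral lborel (\<lambda>\<xi>. entry_kernel s p (h * \<xi>)) ((LINT x|lborel. entry_kernel s p x) / h)"
      using h by (simp add: divide_inverse mult.commute)
    then show ?thesis by (rule has_bochner_integral_mult_right)
  qed
  have "integrable lborel ?f"
  proof (rule Bochner_Integration.integrable_bound)
    show "integrable lborel (\<lambda>\<xi>. h powr (2 - 2 * s) / (2 * pi) * entry_kernel s 0 (h * \<xi>))"
      using kern_h[of 0] by (simp add: has_bochner_integral_iff)
    show "?f \<in> borel_measurable lborel"
    proof -
      have [measurable]: "cis \<in> borel_measurable borel"
        by (intro borel_measurable_continuous_onI continuous_on_cis continuous_on_id)
      show ?thesis unfolding f w_def by measurable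
    qed
    have "norm (?f \<xi>) = \<bar>w \<xi>\<bar>" for \<xi>
      unfolding f by (simp only: norm_mult norm_cis norm_of_real mult_1_right)
    moreover have "w \<xi> = h powr (2 - 2 * s) / (2 * pi) * entry_kernel s 0 (h * \<xi>)" for \<xi>
      using stiffness_integrand_eq[OF h, of \<xi> s 0] by (simp add: w_def)
    ultimately show "AE \<xi> in lborel. norm (?f \<xi>) \<le> norm (h powr (2 - 2 * s) / (2 * pi) * entry_kernel s 0 (h * \<xi>))"
      by (intro AE_I2) (simp only: real_norm_def order_refl)
  qed
  then have "stiffness a b N s k j = (LINT \<xi>|lborel. Re (?f \<xi>))"
    unfolding stiffness_def stiffness_integral_def by (rule integral_Re[symmetric])
  also have "(\<lambda>\<xi>. Re (?f \<xi>)) = (\<lambda>\<xi>. h powr (2 - 2 * s) / (2 * pi) * entry_kernel s p (h * \<xi>))"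
    unfolding f w_def using stiffness_integrand_eq[OF h, of _ s p] by (simp add: fun_eq_iff)
  also have "(LINT \<xi>|lborel. h powr (2 - 2 * s) / (2 * pi) * entry_kernel s p (h * \<xi>)) =
      h powr (2 - 2 * s) / (2 * pi) * ((LINT x|lborel. entry_kernel s p x) / h)"
    using kern_h[of p] by (simp add: has_bochner_integral_iff)
  also have "\<dots> = h powr (1 - 2 * s) / (2 * pi) * (LINT x|lborel. entry_kernel s p x)"
  proof -
    have "h powr (2 - 2 * s) = h * h powr (1 - 2 * s)" using h powr_add[of h 1 "1 - 2 * s"] by simp
    then show ?thesis using h by simp
  qed
  also have "entry_kernel s p = entry_kernel s \<bar>real k - real j\<bar>"
  proof -
    have "entry_kernel s (- p) = entry_kernel s p" by (simp add: entry_kernel_def fun_eq_iff)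
    moreover have "\<bar>real k - real j\<bar> = p \<or> \<bar>real k - real j\<bar> = - p" by (auto simp: p_def)
    ultimately show ?thesis by (elim disjE) simp_all
  qed
  finally show ?thesis .
qed

section \<open>Entries and row sums\<close>

text \<open>The entry at distance \<open>p\<close> from the diagonal for mesh size \<open>1\<close>, divided by \<open>fourth_diff s p\<close>.\<close>

definition entry_scale :: "real \<Rightarrow> real" where
  "entry_scale s = (if s = 1/2 then 1 else sgn (1/2 - s) * kappa s) / (2 * pi)"

lemma entry_scale_pos: "0 < s \<Longrightarrow> s < 3/2 \<Longrightarrow> entry_scale s > 0"
  using kappa_sign[of s] by (simp add: entry_scale_def)

lemma entry_scale_eq_A_coeff: "0 < s \<Longrightarrow> s < 1/2 \<Longrightarrow> entry_scale s = A_coeff s"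
  by (simp add: entry_scale_def kappa_eq)

lemma stiffness_eq:
  assumes "a < b" "N > 0" "k \<ge> 1" "j \<ge> 1" "0 < s" "s < 3/2"
  shows "stiffness a b N s k j =
    entry_scale s * mesh_size a b N powr (1 - 2 * s) * fourth_diff s (nat \<bar>int k - int j\<bar>)"
proof -
  have p: "\<bar>real k - real j\<bar> = real (nat \<bar>int k - int j\<bar>)" by simp
  have "stiffness a b N s k j = mesh_size a b N powr (1 - 2 * s) / (2 * pi) *
      (sgn (1/2 - s) * kappa s * fourth_diff s (nat \<bar>int k - int j\<bar>)
       + (if s = 1/2 then fourth_diff s (nat \<bar>int k - int j\<bar>) else 0))"
    unfolding stiffness_eq_entry_kernel[OF assms] p integral_entry_kernel[OF assms(5,6)] ..
  also have "\<dots> = entry_scale s * mesh_size a b N powr (1 - 2 * s) * fourth_diff s (nat \<bar>int k - int j\<bar>)"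
  proof (cases "s = 1/2")
    case True
    show ?thesis unfolding True entry_scale_def by simp
  qed (simp add: entry_scale_def)
  finally show ?thesis .
qed

lemma sum_offdiag:
  fixes g :: "nat \<Rightarrow> real"
  assumes "k \<in> {1..M}"
  shows "(\<Sum>j\<in>{1..M} - {k}. g (nat \<bar>int k - int j\<bar>)) = (\<Sum>p=1..k - 1. g p) + (\<Sum>p=1..M - k. g p)"
proof -
  have split: "{1..M} - {k} = {1..<k} \<union> {k<..M}" using assms by auto
  have "(\<Sum>j\<in>{1..M} - {k}. g (nat \<bar>int k - int j\<bar>)) =
      (\<Sum>j\<in>{1..<k}. g (nat \<bar>int k - int j\<bar>)) + (\<Sum>j\<in>{k<..M}. g (nat \<bar>int k - int j\<bar>))"
    unfolding split by (rule sum.union_disjoint) auto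
  also have "(\<Sum>j\<in>{1..<k}. g (nat \<bar>int k - int j\<bar>)) = (\<Sum>p=1..k - 1. g p)"
    by (rule sum.reindex_bij_witness[of _ "\<lambda>p. k - p" "\<lambda>j. k - j"]) (auto intro!: arg_cong[of _ _ g])
  also have "(\<Sum>j\<in>{k<..M}. g (nat \<bar>int k - int j\<bar>)) = (\<Sum>p=1..M - k. g p)"
    by (rule sum.reindex_bij_witness[of _ "\<lambda>p. k + p" "\<lambda>j. j - k"]) (auto intro!: arg_cong[of _ _ g])
  finally show ?thesis .
qed

text \<open>One side of the off-diagonal sum of a row, in units of \<open>entry_scale s * h powr (1 - 2 s)\<close>.\<close>

definition half_row_sum :: "real \<Rightarrow> nat \<Rightarrow> real" where
  "half_row_sum s n = (\<Sum>p=1..n. \<bar>fourth_diff s p\<bar>)"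

lemma dominance_gap:
  assumes "a < b" "k \<in> {1..N-1}" "0 < s" "s < 3/2"
  shows "stiffness a b N s k k - offdiag_sum a b N s k =
    entry_scale s * mesh_size a b N powr (1 - 2 * s) * (2 * third_diff s 0 - half_row_sum s (k - 1) - half_row_sum s (N - 1 - k))"
proof -
  let ?c = "entry_scale s * mesh_size a b N powr (1 - 2 * s)"
  have N: "N > 0" and k: "k \<ge> 1" using assms(2) by auto
  have c: "\<bar>entry_scale s\<bar> = entry_scale s" using entry_scale_pos[OF assms(3,4)] by simp
  have "offdiag_sum a b N s k = (\<Sum>j\<in>{1..N-1} - {k}. ?c * \<bar>fourth_diff s (nat \<bar>int k - int j\<bar>)\<bar>)"
    unfolding offdiag_sum_def using c
    by (intro sum.cong refl) (simp add: stiffness_eq[OF assms(1) N k _ assms(3,4)] abs_mult)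
  also have "\<dots> = ?c * (half_row_sum s (k - 1) + half_row_sum s (N - 1 - k))"
    unfolding sum_distrib_left[symmetric] half_row_sum_def sum_offdiag[OF assms(2), of "\<lambda>p. \<bar>fourth_diff s p\<bar>"] by simp
  finally show ?thesis
    using stiffness_eq[OF assms(1) N k k assms(3,4)] by (simp add: fourth_diff_0 algebra_simps)
qed

lemma mesh_size_pos: "a < b \<Longrightarrow> N > 0 \<Longrightarrow> mesh_size a b N > 0"
  by (simp add: mesh_size_def)

lemma sum_third_diff:
  "(\<Sum>p=1..n. fourth_diff s p) = third_diff s n - third_diff s 0"
  by (induction n) (auto simp: fourth_diff_Suc)

text \<open>The logarithmic case comes down to \<open>3 ^ 9 < 2 ^ 16\<close>.\<close>

lemma fourth_diff_1:
  "s \<noteq> 1/2 \<Longrightarrow> fourth_diff s 1 = sgn (1/2 - s) * t1 s"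
  "fourth_diff (1/2) 1 < 0"
proof -
  show "fourth_diff s 1 = sgn (1/2 - s) * t1 s" if "s \<noteq> 1/2"
    using that by (simp add: fourth_diff_def riesz_def t1_eq algebra_simps)
  have "ln ((3::real) ^ 9) < ln (2 ^ 16)" by (subst ln_less_cancel_iff) auto
  then have "9 * ln 3 < 16 * ln (2::real)" by (simp only: ln_realpow zero_less_numeral of_nat_numeral)
  then show "fourth_diff (1/2) 1 < 0" by (simp add: fourth_diff_def riesz_def)
qed

lemma third_diff_1: "third_diff s 1 = third_diff s 0 + fourth_diff s 1"
  using fourth_diff_Suc[of s 0] by simp

lemma fourth_diff_neg:
  assumes "0 < s" "s < 1" "p \<ge> 2" shows "fourth_diff s p < 0"
proof -
  obtain m where "p = Suc m" "m \<ge> 1" using assms(3) by (cases p) auto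
  with third_diff_Suc_less[OF assms(1,2)] show ?thesis by (simp add: fourth_diff_Suc)
qed

lemma fourth_diff_pos:
  assumes "1 < s" "s < 3/2" "p \<ge> 2" shows "fourth_diff s p > 0"
proof -
  obtain m where "p = Suc m" "m \<ge> 1" using assms(3) by (cases p) auto
  with third_diff_Suc_greater[OF assms(1,2)] show ?thesis by (simp add: fourth_diff_Suc)
qed

lemma fourth_diff_1_sign:
  assumes "0 < s" "s < 3/2"
  shows "s < s0 \<Longrightarrow> fourth_diff s 1 > 0" "s = s0 \<Longrightarrow> fourth_diff s 1 = 0" "s0 < s \<Longrightarrow> fourth_diff s 1 < 0"
proof -
  show "fourth_diff s 1 > 0" if "s < s0"
    using that s0_root s0_props(3)[OF that] fourth_diff_1(1)[of s] by simp
  show "fourth_diff s 1 = 0" if "s = s0"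
    using that s0_root fourth_diff_1(1)[of s] by simp
  show "fourth_diff s 1 < 0" if "s0 < s"
  proof -
    consider "s < 1/2" | "s = 1/2" | "s > 1/2" by linarith
    then show ?thesis
    proof cases
      case 1
      with s0_props(4)[OF that] fourth_diff_1(1)[of s] show ?thesis by simp
    next
      case 2
      show ?thesis unfolding 2 by (rule fourth_diff_1(2))
    next
      case 3
      with s0_props(5)[of s] fourth_diff_1(1)[of s] show ?thesis by simp
    qed
  qed
qed

lemma half_row_sum_ge_s0:
  assumes "s0 \<le> s" "s < 1"
  shows "half_row_sum s n = third_diff s 0 - third_diff s n"
proof -
  have s: "0 < s" using assms s0_root by simp
  have "\<bar>fourth_diff s p\<bar> = - fourth_diff s p" if "p \<ge> 1" for p
  proof (cases "p = 1")
    case True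
    then show ?thesis using fourth_diff_1_sign[of s] assms s by (cases "s = s0") auto
  next
    case False
    with that have "p \<ge> 2" by simp
    then show ?thesis using fourth_diff_neg[OF s assms(2)] by fastforce
  qed
  then have "half_row_sum s n = (\<Sum>p=1..n. - fourth_diff s p)"
    unfolding half_row_sum_def by (intro sum.cong) auto
  then show ?thesis using sum_third_diff[of s n] by (simp add: sum_negf)
qed

lemma sum_from_2:
  fixes f :: "nat \<Rightarrow> real"
  assumes "n \<ge> 1"
  shows "(\<Sum>p=1..n. f p) = f 1 + (\<Sum>p=2..n. f p)"
  using assms by (simp add: sum.atLeast_Suc_atMost numeral_2_eq_2)

text \<open>Only the neighbour of the diagonal is positive; flipping its sign in the telescoping sum costs \<open>2 t1 s\<close>.\<close>

lemma half_row_sum_less_s0: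
  assumes "0 < s" "s < s0" "n \<ge> 1"
  shows "half_row_sum s n = third_diff s 0 - third_diff s n + 2 * t1 s"
proof -
  have s: "s < 1/2" "s < 1" "s < 3/2" using assms s0_root by auto
  have 1: "fourth_diff s 1 = t1 s" "fourth_diff s 1 > 0"
    using fourth_diff_1(1)[of s] fourth_diff_1_sign(1)[of s] assms s by auto
  have "(\<Sum>p=2..n. \<bar>fourth_diff s p\<bar>) = (\<Sum>p=2..n. - fourth_diff s p)"
    using fourth_diff_neg[OF assms(1) s(2)] by (intro sum.cong refl abs_of_neg) auto
  then have "half_row_sum s n = fourth_diff s 1 - (\<Sum>p=2..n. fourth_diff s p)"
    unfolding half_row_sum_def sum_from_2[OF assms(3)] using 1(2) by (simp add: sum_negf)
  also have "(\<Sum>p=2..n. fourth_diff s p) = third_diff s n - third_diff s 0 - fourth_diff s 1"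
    using sum_third_diff[of s n] sum_from_2[OF assms(3), of "fourth_diff s"] by simp
  finally show ?thesis using 1(1) by simp
qed

text \<open>Only the neighbour of the diagonal is negative, so the telescoping sum changes sign at \<open>third_diff s 1\<close>.\<close>

lemma half_row_sum_greater_1:
  assumes "1 < s" "s < 3/2" "n \<ge> 1"
  shows "half_row_sum s n = third_diff s 0 + third_diff s n - 2 * third_diff s 1"
proof -
  have 1: "fourth_diff s 1 < 0"
    using third_diff_neg[OF assms(1,2), of 1] third_diff_0_pos[of s] assms third_diff_1[of s] by simp
  have "(\<Sum>p=2..n. \<bar>fourth_diff s p\<bar>) = (\<Sum>p=2..n. fourth_diff s p)"
    using fourth_diff_pos[OF assms(1,2)] by (intro sum.cong refl abs_of_pos) auto
  then have "half_row_sum s n = - fourth_diff s 1 + (\<Sum>p=2..n. fourth_diff s p)"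
    unfolding half_row_sum_def sum_from_2[OF assms(3)] using 1 by simp
  also have "(\<Sum>p=2..n. fourth_diff s p) = third_diff s n - third_diff s 0 - fourth_diff s 1"
    using sum_third_diff[of s n] sum_from_2[OF assms(3), of "fourth_diff s"] by simp
  finally show ?thesis using third_diff_1[of s] by simp
qed

lemma half_row_sum_0 [simp]: "half_row_sum s 0 = 0"
  by (simp add: half_row_sum_def)

text \<open>Bernoulli's inequality for \<open>(c / y) powr b\<close>. It reduces sums of the powers \<open>y powr (- 2 s)\<close> to rational
inequalities in the nodes that do not involve \<open>s\<close>.\<close>

lemma powr_minus_le_tangent:
  fixes c y b :: real
  assumes "c > 0" "y > 0" "0 \<le> b" "b \<le> 1"
  shows "y powr (- b) \<le> c powr (- b) * (1 + b * (c / y - 1))"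
proof -
  have "y powr (- b) = c powr (- b) * (c / y) powr b"
    using assms by (simp add: powr_divide powr_minus field_simps)
  also have "\<dots> \<le> c powr (- b) * (1 + b * (c / y - 1))"
    by (intro mult_left_mono powr_le_affine) (use assms in auto)
  finally show ?thesis .
qed

text \<open>The average in \<open>third_diff_le\<close> is centred at \<open>m + 1/2\<close>, and the slack of \<open>1/2\<close> absorbs the convexity defect.
This bounds the gap of the middle row for even \<open>N\<close>.\<close>

lemma third_diff_le_powr:
  assumes s: "0 < s" "s < 1/2" and "m \<ge> 2"
  shows "third_diff s m \<le> 2 * gam s * real m powr (- 2 * s)"
proof -
  define c where "c = real m"
  have c: "c \<ge> 2" using assms by (simp add: c_def)
  let ?w = "c powr (- (2 * s))"
  have b: "y powr (- (2 * s)) \<le> ?w * (1 + 2 * s * (c / y - 1))" if "y > 0" for y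
    by (rule powr_minus_le_tangent) (use that c s in auto)
  have "(c - 1) powr (- (2 * s)) + 3 * c powr (- (2 * s)) + 3 * (c + 1) powr (- (2 * s)) + (c + 2) powr (- (2 * s))
    \<le> ?w * (1 + 2 * s * (c / (c - 1) - 1)) + 3 * ?w + 3 * (?w * (1 + 2 * s * (c / (c + 1) - 1)))
      + ?w * (1 + 2 * s * (c / (c + 2) - 1))"
    using b[of "c - 1"] b[of "c + 1"] b[of "c + 2"] c by simp
  also have "\<dots> = ?w * (8 + 2 * s * (c / (c - 1) + 3 * (c / (c + 1)) + c / (c + 2) - 5))"
    by (simp add: algebra_simps)
  also have "\<dots> \<le> ?w * (8 + 2 * s * 0)"
  proof (intro mult_left_mono add_left_mono)
    have "c / (c - 1) - 1 \<le> 3 * (1 - c / (c + 1))" "c / (c + 2) \<le> 1"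
      using c by (simp_all add: field_simps)
    moreover have "u - 1 \<le> 3 * (1 - v) \<Longrightarrow> w \<le> 1 \<Longrightarrow> u + 3 * v + w - 5 \<le> 0" for u v w :: real
      by simp
    ultimately show "c / (c - 1) + 3 * (c / (c + 1)) + c / (c + 2) - 5 \<le> 0" by blast
  qed (use s in auto)
  finally have "(c - 1) powr (- (2 * s)) + 3 * c powr (- (2 * s)) + 3 * (c + 1) powr (- (2 * s)) + (c + 2) powr (- (2 * s))
    \<le> 8 * ?w" by simp
  then have "gam s / 4 * ((c - 1) powr (- (2 * s)) + 3 * c powr (- (2 * s)) + 3 * (c + 1) powr (- (2 * s)) + (c + 2) powr (- (2 * s)))
    \<le> gam s / 4 * (8 * ?w)"
    by (intro mult_left_mono) (use gam_pos[OF s] in auto)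
  with third_diff_le[OF assms] show ?thesis by (simp add: c_def)
qed

text \<open>The version for odd \<open>N\<close>, where the two halves of the middle row have lengths \<open>m\<close> and \<open>m + 1\<close>.\<close>

lemma third_diff_add_le_powr:
  assumes s: "0 < s" "s < 1/2" and "m \<ge> 2"
  shows "third_diff s m + third_diff s (Suc m) \<le> 4 * gam s * (real m + 1/2) powr (- 2 * s)"
proof -
  define x where "x = real m"
  have x: "x \<ge> 2" using assms by (simp add: x_def)
  define c where "c = x + 1/2"
  let ?w = "c powr (- (2 * s))"
  let ?p = "\<lambda>y. y powr (- (2 * s))"
  have b: "?p y \<le> ?w * (1 + 2 * s * (c / y - 1))" if "y > 0" for y
    by (rule powr_minus_le_tangent) (use that x s in \<open>auto simp: c_def\<close>)
  have "?p (x - 1) + 4 * ?p x + 6 * ?p (x + 1) + 4 * ?p (x + 2) + ?p (x + 3)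
    \<le> ?w * (1 + 2 * s * (c / (x - 1) - 1)) + 4 * (?w * (1 + 2 * s * (c / x - 1)))
      + 6 * (?w * (1 + 2 * s * (c / (x + 1) - 1))) + 4 * (?w * (1 + 2 * s * (c / (x + 2) - 1)))
      + ?w * (1 + 2 * s * (c / (x + 3) - 1))"
    using b[of "x - 1"] b[of x] b[of "x + 1"] b[of "x + 2"] b[of "x + 3"] x by simp
  also have "\<dots> = ?w * (16 + 2 * s * (c / (x - 1) + 4 * (c / x) + 6 * (c / (x + 1)) + 4 * (c / (x + 2)) + c / (x + 3) - 16))"
    by (simp add: algebra_simps)
  also have "\<dots> \<le> ?w * (16 + 2 * s * 0)"
  proof (intro mult_left_mono add_left_mono)
    have "c / (x - 1) - 1 \<le> 4 * (1 - c / (x + 2))" "4 * (c / x - 1) \<le> 6 * (1 - c / (x + 1))" "c / (x + 3) \<le> 1"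
      using x by (simp_all add: c_def field_simps)
    moreover have "u1 - 1 \<le> 4 * (1 - u4) \<Longrightarrow> 4 * (u2 - 1) \<le> 6 * (1 - u3) \<Longrightarrow> u5 \<le> 1 \<Longrightarrow>
        u1 + 4 * u2 + 6 * u3 + 4 * u4 + u5 - 16 \<le> 0" for u1 u2 u3 u4 u5 :: real
      by simp
    ultimately show "c / (x - 1) + 4 * (c / x) + 6 * (c / (x + 1)) + 4 * (c / (x + 2)) + c / (x + 3) - 16 \<le> 0" by blast
  qed (use s in auto)
  finally have "?p (x - 1) + 4 * ?p x + 6 * ?p (x + 1) + 4 * ?p (x + 2) + ?p (x + 3) \<le> 16 * ?w" by simp
  then have "gam s / 4 * (?p (x - 1) + 4 * ?p x + 6 * ?p (x + 1) + 4 * ?p (x + 2) + ?p (x + 3)) \<le> gam s / 4 * (16 * ?w)"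
    by (intro mult_left_mono) (use gam_pos[OF s] in auto)
  moreover have "third_diff s m \<le> gam s / 4 * (?p (x - 1) + 3 * ?p x + 3 * ?p (x + 1) + ?p (x + 2))"
    using third_diff_le[OF assms] by (simp add: x_def)
  moreover have "third_diff s (Suc m) \<le> gam s / 4 * (?p x + 3 * ?p (x + 1) + 3 * ?p (x + 2) + ?p (x + 3))"
    using third_diff_le[OF s, of "Suc m"] assms(3) by (simp add: x_def add.commute)
  ultimately have "third_diff s m + third_diff s (Suc m) \<le> gam s / 4 * (16 * ?w)"
    by (simp add: algebra_simps)
  then show ?thesis by (simp add: c_def x_def)
qed

section \<open>Signs of the entries and diagonal dominance\<close>

lemma stiffness_sign:
  assumes "a < b" "k \<in> {1..N-1}" "j \<in> {1..N-1}" "0 < s" "s < 3/2"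
  defines "p \<equiv> nat \<bar>int k - int j\<bar>"
  shows "stiffness a b N s k j > 0 \<longleftrightarrow> fourth_diff s p > 0"
    and "stiffness a b N s k j < 0 \<longleftrightarrow> fourth_diff s p < 0"
    and "stiffness a b N s k j = 0 \<longleftrightarrow> fourth_diff s p = 0"
proof -
  have N: "N > 0" "k \<ge> 1" "j \<ge> 1" using assms by auto
  have "mesh_size a b N powr (1 - 2 * s) > 0" using mesh_size_pos[OF assms(1) N(1)] by simp
  then have c: "entry_scale s * mesh_size a b N powr (1 - 2 * s) > 0"
    using entry_scale_pos[OF assms(4,5)] by simp
  show "stiffness a b N s k j > 0 \<longleftrightarrow> fourth_diff s p > 0"
    "stiffness a b N s k j < 0 \<longleftrightarrow> fourth_diff s p < 0"
    "stiffness a b N s k j = 0 \<longleftrightarrow> fourth_diff s p = 0"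
    unfolding stiffness_eq[OF assms(1) N assms(4,5)] p_def
    using c by (simp_all add: zero_less_mult_iff mult_less_0_iff)
qed

lemma gap_sign:
  assumes "a < b" "k \<in> {1..N-1}" "0 < s" "s < 3/2"
  defines "D \<equiv> 2 * third_diff s 0 - half_row_sum s (k - 1) - half_row_sum s (N - 1 - k)"
  shows "stiffness a b N s k k > offdiag_sum a b N s k \<longleftrightarrow> D > 0"
    and "stiffness a b N s k k < offdiag_sum a b N s k \<longleftrightarrow> D < 0"
proof -
  have "N > 0" using assms(2) by auto
  then have c: "entry_scale s * mesh_size a b N powr (1 - 2 * s) > 0"
    using entry_scale_pos[OF assms(3,4)] mesh_size_pos[OF assms(1) \<open>N > 0\<close>] by simp
  have g: "stiffness a b N s k k - offdiag_sum a b N s k = entry_scale s * mesh_size a b N powr (1 - 2 * s) * D"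
    unfolding D_def by (rule dominance_gap[OF assms(1-4)])
  have "stiffness a b N s k k > offdiag_sum a b N s k \<longleftrightarrow> stiffness a b N s k k - offdiag_sum a b N s k > 0"
    "stiffness a b N s k k < offdiag_sum a b N s k \<longleftrightarrow> stiffness a b N s k k - offdiag_sum a b N s k < 0"
    by auto
  then show "stiffness a b N s k k > offdiag_sum a b N s k \<longleftrightarrow> D > 0"
    "stiffness a b N s k k < offdiag_sum a b N s k \<longleftrightarrow> D < 0"
    unfolding g using c by (simp_all add: zero_less_mult_iff mult_less_0_iff)
qed

lemma stiffness_diag_pos:
  assumes "a < b" "k \<in> {1..N-1}" "0 < s" "s < 3/2"
  shows "stiffness a b N s k k > 0"
  using stiffness_sign(1)[OF assms(1,2,2,3,4)] third_diff_0_pos[OF assms(3,4)]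
  by (simp add: fourth_diff_0)

lemma dominated_ge_s0:
  assumes "a < b" "s0 \<le> s" "s < 1"
  shows "strictly_pos_diag_dominated a b N s"
  unfolding strictly_pos_diag_dominated_def
proof
  fix k assume k: "k \<in> {1..N-1}"
  have s: "0 < s" "s < 3/2" using assms s0_root by auto
  show "stiffness a b N s k k > offdiag_sum a b N s k"
    unfolding gap_sign(1)[OF assms(1) k s] half_row_sum_ge_s0[OF assms(2,3)]
    using third_diff_pos[OF s(1) assms(3), of "k - 1"] third_diff_pos[OF s(1) assms(3), of "N - 1 - k"]
    by simp
qed

lemma gap_less_s0:
  assumes "0 < s" "s < s0" "k \<in> {1..N-1}"
  shows "2 * third_diff s 0 - half_row_sum s (k - 1) - half_row_sum s (N - 1 - k) =
    third_diff s (k - 1) + third_diff s (N - 1 - k)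
    - 2 * ((if k = 1 then 0 else 1) + (if k = N - 1 then 0 else 1)) * t1 s"
proof -
  have "half_row_sum s n = third_diff s 0 - third_diff s n + (if n = 0 then 0 else 2 * t1 s)" for n
    using half_row_sum_less_s0[OF assms(1,2), of n] by (cases "n = 0") auto
  moreover have "k - 1 = 0 \<longleftrightarrow> k = 1" "N - 1 - k = 0 \<longleftrightarrow> k = N - 1" using assms(3) by auto
  ultimately show ?thesis by (simp only:) (simp add: algebra_simps)
qed

lemma gap_lower_bound:
  assumes "a < b" "0 < s" "s < s0" "k \<in> {1..N-1}"
  shows "stiffness a b N s k k - offdiag_sum a b N s k > - (4 * A_coeff s * t1 s / mesh_size a b N powr (2 * s - 1))"
proof -
  have s: "s < 1/2" "s < 1" "s < 3/2" using assms s0_root by auto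
  have N: "N > 0" using assms(4) by auto
  let ?c = "entry_scale s * mesh_size a b N powr (1 - 2 * s)"
  have c: "?c > 0" using entry_scale_pos[OF assms(2) s(3)] mesh_size_pos[OF assms(1) N] by simp
  have t: "t1 s > 0" using s0_props(3) assms by simp
  have "third_diff s (k - 1) + third_diff s (N - 1 - k)
    - 2 * ((if k = 1 then 0 else 1) + (if k = N - 1 then 0 else 1)) * t1 s > - 4 * t1 s"
    using third_diff_pos[OF assms(2) s(2), of "k - 1"] third_diff_pos[OF assms(2) s(2), of "N - 1 - k"] t
    by auto
  then have "?c * (- 4 * t1 s) < stiffness a b N s k k - offdiag_sum a b N s k"
    unfolding dominance_gap[OF assms(1,4,2) s(3)] gap_less_s0[OF assms(2-4)]
    using c by (rule mult_strict_left_mono)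
  also have "?c = A_coeff s / mesh_size a b N powr (2 * s - 1)"
    using entry_scale_eq_A_coeff[OF assms(2) s(1)] powr_minus_divide[of "mesh_size a b N" "2 * s - 1"] by simp
  finally show ?thesis by (simp add: mult_ac)
qed

text \<open>In rows with two neighbours, \<open>third_diff_gt\<close> and convexity of \<open>\<Phi>'''\<close> bound the row sum below by twice the value
of \<open>\<Phi>'''\<close> at \<open>N / 2\<close>, and \<open>N \<le> N0 s\<close> says that this value is at least \<open>2 t1 s\<close>. The end rows lose only
\<open>2 t1 s\<close>, which \<open>third_diff s 0\<close> alone exceeds.\<close>

lemma dominated_if_le_N0:
  assumes "a < b" "0 < s" "s < s0" "int N \<le> N0 s"
  shows "strictly_pos_diag_dominated a b N s"
  unfolding strictly_pos_diag_dominated_def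
proof
  fix k assume k: "k \<in> {1..N-1}"
  have s: "s < 1/2" "s < 1" "s < 3/2" using assms s0_root by auto
  have t: "t1 s > 0" using s0_props(3) assms by simp
  note pos = third_diff_pos[OF assms(2) s(2)]
  have t0: "third_diff s 0 > 2 * t1 s"
    using two_t1_less[OF assms(2) s(1)] s by (simp add: third_diff_0 riesz_def)
  have "third_diff s (k - 1) + third_diff s (N - 1 - k)
    - 2 * ((if k = 1 then 0 else 1) + (if k = N - 1 then 0 else 1)) * t1 s > 0"
  proof (cases "k = 1 \<or> k = N - 1")
    case True
    then have "third_diff s (k - 1) + third_diff s (N - 1 - k) > 2 * t1 s"
      using t0 pos[of "k - 1"] pos[of "N - 1 - k"] by auto
    with True t show ?thesis by auto
  next
    case False
    with k have k': "2 \<le> k" "k \<le> N - 2" by auto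
    have r: "real (k - 1) + 1 = real k" "real (N - 1 - k) + 1 = real N - real k"
      using k' by (simp_all add: of_nat_diff)
    have n: "k - 1 \<ge> 1" "N - 1 - k \<ge> 1" using k' by auto
    have N: "real N > 0" using k' by simp
    define X where "X = (gam s / t1 s) powr (1 / (2 * s))"
    have "real N / 2 \<le> X" using assms(4) by (simp add: N0_def X_def le_floor_iff)
    then have "(real N / 2) powr (2 * s) \<le> X powr (2 * s)"
      using assms(2) N by (intro powr_mono2) auto
    also have "X powr (2 * s) = gam s / t1 s"
      using gam_pos[OF assms(2) s(1)] t assms(2) by (simp add: X_def powr_powr)
    finally have "t1 s * (real N / 2) powr (2 * s) \<le> gam s" using t by (simp add: field_simps)
    then have "t1 s \<le> gam s * (real N / 2) powr (- 2 * s)"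
      using N by (simp add: powr_minus field_simps)
    then have "4 * t1 s \<le> 2 * riesz_deriv s 3 (real N / 2)" by (simp add: riesz_deriv_3[OF assms(2) s(1)])
    also have "\<dots> \<le> riesz_deriv s 3 (real k) + riesz_deriv s 3 (real N - real k)"
      using convex_on_midpoint[OF convex_riesz_deriv_3[OF assms(2) s(1)], of "real k" "real N - real k"] k'
      by simp
    also have "\<dots> < third_diff s (k - 1) + third_diff s (N - 1 - k)"
      using third_diff_gt[OF assms(2) s(1) n(1)] third_diff_gt[OF assms(2) s(1) n(2)]
      unfolding r by simp
    finally show ?thesis using False by simp
  qed
  then show "stiffness a b N s k k > offdiag_sum a b N s k"
    unfolding gap_sign(1)[OF assms(1) k assms(2) s(3)] gap_less_s0[OF assms(2,3) k] .
qed

text \<open>If \<open>N \<ge> N0 s + 3\<close>, then \<open>(N - 2) / 2\<close> exceeds \<open>(gam s / t1 s) powr (1 / (2 s))\<close>, and the middle row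
fails to be dominant by the upper bounds for third differences.\<close>

lemma le_N0_if_dominated:
  assumes "a < b" "0 < s" "s < s0" "strictly_pos_diag_dominated a b N s"
  shows "int N \<le> N0 s + 2"
proof (rule ccontr)
  assume "\<not> ?thesis"
  then have N0: "N0 s + 3 \<le> int N" by simp
  have s: "s < 1/2" "s < 1/4" "s < 3/2" using assms s0_props(2) by auto
  have t: "t1 s > 0" using s0_props(3) assms by simp
  have g: "gam s > 0" by (rule gam_pos[OF assms(2) s(1)])
  define X where "X = (gam s / t1 s) powr (1 / (2 * s))"
  have X: "X powr (2 * s) = gam s / t1 s"
    using g t assms(2) by (simp add: X_def powr_powr)
  have "X \<ge> 0" by (simp add: X_def)
  have N: "real N > 2 * X + 2"
  proof -
    have "real_of_int (N0 s) > 2 * X - 1" unfolding N0_def X_def by linarith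
    moreover have "real_of_int (N0 s + 3) \<le> real_of_int (int N)" using N0 by (simp only: of_int_le_iff)
    ultimately show ?thesis by simp
  qed
  have "X \<ge> 3/2"
  proof (rule ccontr)
    assume "\<not> X \<ge> 3/2"
    then have "X powr (2 * s) < (3/2) powr (2 * s)"
      using assms(2) \<open>X \<ge> 0\<close> by (intro powr_less_mono2) auto
    also have "\<dots> \<le> gam s / t1 s"
      using t1_gam_bound[OF assms(2) s(2)] t by (simp add: field_simps)
    finally show False using X by simp
  qed
  with N have "N \<ge> 6" by simp
  \<comment> \<open>The half-length of the middle row, at which the upper bounds for third differences are evaluated.\<close>
  define c where "c = (real N - 2) / 2"
  have c: "c > X" "c > 0" using N \<open>X \<ge> 3/2\<close> by (auto simp: c_def)
  then have "gam s / t1 s < c powr (2 * s)"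
    unfolding X[symmetric] using assms(2) \<open>X \<ge> 0\<close> by (intro powr_less_mono2) auto
  then have tc: "gam s * c powr (- 2 * s) < t1 s"
    using t c by (simp add: powr_minus field_simps)
  define k where "k = N div 2"
  have k: "k \<in> {1..N-1}" "k \<noteq> 1" "k \<noteq> N - 1" using \<open>N \<ge> 6\<close> by (auto simp: k_def)
  have "third_diff s (k - 1) + third_diff s (N - 1 - k) \<le> 4 * gam s * c powr (- 2 * s)"
  proof (cases "even N")
    case True
    then have e: "N - 1 - k = k - 1" "real (k - 1) = c" "k - 1 \<ge> 2"
      using \<open>N \<ge> 6\<close> by (auto simp: k_def c_def elim!: evenE)
    show ?thesis using third_diff_le_powr[OF assms(2) s(1) e(3)] unfolding e(1,2) by simp
  next
    case False
    then have e: "N - 1 - k = Suc (k - 1)" "real (k - 1) + 1/2 = c" "k - 1 \<ge> 2"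
      using \<open>N \<ge> 6\<close> by (auto simp: k_def c_def elim!: oddE)
    show ?thesis using third_diff_add_le_powr[OF assms(2) s(1) e(3)] unfolding e(1,2) .
  qed
  also have "\<dots> < 4 * t1 s" using tc by simp
  finally have "2 * third_diff s 0 - half_row_sum s (k - 1) - half_row_sum s (N - 1 - k) < 0"
    unfolding gap_less_s0[OF assms(2,3) k(1)] using k(2,3) by simp
  moreover have "2 * third_diff s 0 - half_row_sum s (k - 1) - half_row_sum s (N - 1 - k) > 0"
    using assms(4) k(1) gap_sign(1)[OF assms(1) k(1) assms(2) s(3)]
    unfolding strictly_pos_diag_dominated_def by blast
  ultimately show False by linarith
qed

text \<open>With \<open>x = 3 - 2 s\<close> in the unit interval the sum is \<open>5 * 2 powr x - 2 * 3 powr x - 2\<close>, and \<open>(3/2) powr x \<le> 1 + x / 2\<close>.\<close>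

lemma third_diff_0_add_1_pos:
  assumes "1 < s" "s < 3/2"
  shows "third_diff s 0 + 2 * third_diff s 1 > 0"
proof -
  define x where "x = 3 - 2 * s"
  have x: "0 < x" "x < 1" using assms by (auto simp: x_def)
  have "(3/2) powr x \<le> 1 + x * (3/2 - 1 :: real)" by (rule powr_le_affine) (use x in auto)
  then have "2 powr x * (3/2) powr x \<le> 2 powr x * (1 + x / 2)" by (intro mult_left_mono) auto
  moreover have "2 powr x * (3/2) powr x = (3::real) powr x" by (simp add: powr_divide)
  ultimately have 3: "3 powr x \<le> 2 powr x * (1 + x / 2)" by simp
  have "1 < 2 powr x * 1" using x by simp
  also have "\<dots> < 2 powr x * ((3 - x) / 2)" using x by (intro mult_strict_left_mono) auto
  finally have "2 < 5 * 2 powr x - 2 * (2 powr x * (1 + x / 2))" by (simp add: field_simps)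
  with 3 have "2 < 5 * 2 powr x - 2 * 3 powr x" by linarith
  moreover have "third_diff s 0 = 4 - 2 powr x" "third_diff s 1 = 3 * 2 powr x - 3 powr x - 3"
    using assms by (simp_all add: third_diff_def riesz_def x_def)
  ultimately show ?thesis by simp
qed

lemma dominated_end_rows:
  assumes "a < b" "N \<ge> 2" "1 < s" "s < 3/2" "k \<in> {1, N-1}"
  shows "stiffness a b N s k k > offdiag_sum a b N s k"
proof -
  have k: "k \<in> {1..N-1}" and s: "0 < s" using assms by auto
  have T0: "third_diff s 0 > 0" by (rule third_diff_0_pos[OF s assms(4)])
  have "2 * third_diff s 0 - half_row_sum s (N - 2) > 0"
  proof (cases "N = 2")
    case True
    with T0 show ?thesis by simp
  next
    case False
    with assms(2) have "N - 2 \<ge> 1" by simp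
    from half_row_sum_greater_1[OF assms(3,4) this] third_diff_neg[OF assms(3,4) this] third_diff_0_add_1_pos[OF assms(3,4)]
    show ?thesis by simp
  qed
  moreover have "half_row_sum s (k - 1) + half_row_sum s (N - 1 - k) = half_row_sum s (N - 2)"
    using assms(2,5) by (auto simp: numeral_2_eq_2)
  ultimately show ?thesis unfolding gap_sign(1)[OF assms(1) k s assms(4)] by simp
qed

lemma not_dominated_inner_rows:
  assumes "a < b" "1 < s" "s < 3/2" "k \<in> {2..N-2}"
  shows "stiffness a b N s k k < offdiag_sum a b N s k"
proof -
  have k: "k \<in> {1..N-1}" and s: "0 < s" using assms by auto
  have ge: "third_diff s 1 \<le> third_diff s n" if "n \<ge> 1" for n
    using that
  proof (induction n rule: dec_induct)
    case (step n)
    with third_diff_Suc_greater[OF assms(2,3), of n] show ?case by simp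
  qed simp
  have n: "k - 1 \<ge> 1" "N - 1 - k \<ge> 1" using assms(4) by auto
  show ?thesis
    unfolding gap_sign(2)[OF assms(1) k s assms(3)] half_row_sum_greater_1[OF assms(2,3) n(1)]
      half_row_sum_greater_1[OF assms(2,3) n(2)]
    using ge[OF n(1)] ge[OF n(2)] third_diff_neg[OF assms(2,3), of 1] by simp
qed

theorem theorem2:
  fixes a b :: real and N :: nat
  assumes "a < b" and "N \<ge> 2"
  shows
    "(\<exists>!s. 0 < s \<and> s < 1/2 \<and> t1 s = 0) \<and> \<bar>s0 - 0.2374\<bar> < 0.00005 \<and>
     (\<forall>s. 0 < s \<and> s < 3/2 \<longrightarrow>
        (\<forall>k\<in>{1..N-1}. \<forall>j\<in>{1..N-1}. stiffness_integral a b N s k j \<in> \<real>)) \<and>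
     (\<forall>s. s0 \<le> s \<and> s < 1 \<longrightarrow>
        (\<forall>k\<in>{1..N-1}. stiffness a b N s k k > 0) \<and>
        (\<forall>k\<in>{1..N-1}. \<forall>j\<in>{1..N-1}. k \<noteq> j \<longrightarrow>
           (if s = s0 \<and> \<bar>int k - int j\<bar> = 1
            then stiffness a b N s k j = 0
            else stiffness a b N s k j < 0)) \<and>
        strictly_pos_diag_dominated a b N s) \<and>
     (\<forall>s. 0 < s \<and> s < s0 \<longrightarrow>
        (\<forall>k\<in>{1..N-1}. stiffness a b N s k k > 0) \<and>
        (\<forall>k\<in>{1..N-1}. \<forall>j\<in>{1..N-1}. \<bar>int k - int j\<bar> = 1 \<longrightarrow>
           stiffness a b N s k j > 0) \<and>
        (\<forall>k\<in>{1..N-1}. \<forall>j\<in>{1..N-1}. \<bar>int k - int j\<bar> \<ge> 2 \<longrightarrow>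
           stiffness a b N s k j < 0) \<and>
        (\<forall>k\<in>{1..N-1}. stiffness a b N s k k - offdiag_sum a b N s k >
           - (4 * A_coeff s * t1 s / mesh_size a b N powr (2 * s - 1))) \<and>
        0 < t1 s \<and> t1 s < 2 \<and>
        (int N \<le> N0 s \<longrightarrow> strictly_pos_diag_dominated a b N s) \<and>
        (strictly_pos_diag_dominated a b N s \<longrightarrow> int N \<le> N0 s + 2)) \<and>
     (\<forall>s. 1 < s \<and> s < 3/2 \<longrightarrow>
        (\<forall>k\<in>{1..N-1}. stiffness a b N s k k > 0) \<and>
        (\<forall>k\<in>{1..N-1}. \<forall>j\<in>{1..N-1}. \<bar>int k - int j\<bar> = 1 \<longrightarrow>
           stiffness a b N s k j < 0) \<and>
        (\<forall>k\<in>{1..N-1}. \<forall>j\<in>{1..N-1}. \<bar>int k - int j\<bar> \<ge> 2 \<longrightarrow>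
           stiffness a b N s k j > 0) \<and>
        (\<forall>k\<in>{1, N-1}. stiffness a b N s k k > offdiag_sum a b N s k) \<and>
        (N \<ge> 4 \<longrightarrow> (\<forall>k\<in>{2..N-2}. stiffness a b N s k k < offdiag_sum a b N s k)))"
proof (intro conjI allI impI ballI)
  show "\<exists>!s. 0 < s \<and> s < 1/2 \<and> t1 s = 0" by (rule ex1_t1_root)
  show "\<bar>s0 - 0.2374\<bar> < 0.00005" by (rule s0_props(1))
  show "stiffness_integral a b N s k j \<in> \<real>" for s k j by (rule stiffness_integral_real)
next
  fix s assume s: "s0 \<le> s \<and> s < 1"
  then have s': "0 < s" "s < 1" "s < 3/2" using s0_root by auto
  show "stiffness a b N s k k > 0" if "k \<in> {1..N-1}" for k
    by (rule stiffness_diag_pos[OF assms(1) that s'(1,3)])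
  show "strictly_pos_diag_dominated a b N s" using dominated_ge_s0[OF assms(1)] s by blast
  fix k j assume k: "k \<in> {1..N-1}" and j: "j \<in> {1..N-1}" and "k \<noteq> j"
  define p where "p = nat \<bar>int k - int j\<bar>"
  have p: "p \<ge> 1" "\<bar>int k - int j\<bar> = 1 \<longleftrightarrow> p = 1" using \<open>k \<noteq> j\<close> by (auto simp: p_def)
  have "fourth_diff s p < 0" if "\<not> (s = s0 \<and> p = 1)"
  proof (cases "p = 1")
    case True
    with that s fourth_diff_1_sign(3)[OF s'(1,3)] show ?thesis by simp
  next
    case False
    with p fourth_diff_neg[OF s'(1,2)] show ?thesis by simp
  qed
  moreover have "fourth_diff s p = 0" if "s = s0 \<and> p = 1"
    using that fourth_diff_1_sign(2)[OF s'(1,3)] by simp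
  ultimately show "if s = s0 \<and> \<bar>int k - int j\<bar> = 1 then stiffness a b N s k j = 0
      else stiffness a b N s k j < 0"
    unfolding stiffness_sign(2,3)[OF assms(1) k j s'(1,3), folded p_def] p(2) by simp
next
  fix s assume s: "0 < s \<and> s < s0"
  then have s': "0 < s" "s < s0" "s < 1/2" "s < 1" "s < 3/2" using s0_root by auto
  show "stiffness a b N s k k > 0" if "k \<in> {1..N-1}" for k
    by (rule stiffness_diag_pos[OF assms(1) that s'(1,5)])
  show "stiffness a b N s k j > 0" if "k \<in> {1..N-1}" "j \<in> {1..N-1}" "\<bar>int k - int j\<bar> = 1" for k j
    unfolding stiffness_sign(1)[OF assms(1) that(1,2) s'(1,5)] that(3)
    using fourth_diff_1_sign(1)[OF s'(1,5,2)] by simp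
  show "stiffness a b N s k j < 0" if "k \<in> {1..N-1}" "j \<in> {1..N-1}" "\<bar>int k - int j\<bar> \<ge> 2" for k j
    unfolding stiffness_sign(2)[OF assms(1) that(1,2) s'(1,5)]
    by (rule fourth_diff_neg[OF s'(1,4)]) (use that(3) in simp)
  show "stiffness a b N s k k - offdiag_sum a b N s k >
      - (4 * A_coeff s * t1 s / mesh_size a b N powr (2 * s - 1))" if "k \<in> {1..N-1}" for k
    by (rule gap_lower_bound[OF assms(1) s'(1,2) that])
  show "0 < t1 s" by (rule s0_props(3)[OF s'(2)])
  show "t1 s < 2" by (rule t1_less_2[OF s'(1,3)])
  show "strictly_pos_diag_dominated a b N s" if "int N \<le> N0 s"
    by (rule dominated_if_le_N0[OF assms(1) s'(1,2) that])
  show "int N \<le> N0 s + 2" if "strictly_pos_diag_dominated a b N s"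
    by (rule le_N0_if_dominated[OF assms(1) s'(1,2) that])
next
  fix s :: real assume s: "1 < s \<and> s < 3/2"
  then have s': "0 < s" "1 < s" "s < 3/2" "s0 < s" using s0_root by auto
  show "stiffness a b N s k k > 0" if "k \<in> {1..N-1}" for k
    by (rule stiffness_diag_pos[OF assms(1) that s'(1,3)])
  show "stiffness a b N s k j < 0" if "k \<in> {1..N-1}" "j \<in> {1..N-1}" "\<bar>int k - int j\<bar> = 1" for k j
    unfolding stiffness_sign(2)[OF assms(1) that(1,2) s'(1,3)] that(3)
    using fourth_diff_1_sign(3)[OF s'(1,3,4)] by simp
  show "stiffness a b N s k j > 0" if "k \<in> {1..N-1}" "j \<in> {1..N-1}" "\<bar>int k - int j\<bar> \<ge> 2" for k j
    unfolding stiffness_sign(1)[OF assms(1) that(1,2) s'(1,3)]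
    by (rule fourth_diff_pos[OF s'(2,3)]) (use that(3) in simp)
  show "stiffness a b N s k k > offdiag_sum a b N s k" if "k \<in> {1, N-1}" for k
    by (rule dominated_end_rows[OF assms s'(2,3) that])
  show "stiffness a b N s k k < offdiag_sum a b N s k" if "N \<ge> 4" "k \<in> {2..N-2}" for k
    by (rule not_dominated_inner_rows[OF assms(1) s'(2,3) that(2)])
qed

end
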